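(* For $n\ge 3$, let $\mathcal{MCG}(\mathbb{S}^2,n)\cong B_n(\mathbb{S}^2)/\langle\Delta_n^2\rangle$ be the mapping class group of the $2$-sphere with $n$ marked points. For $i\in\{0,1,2\}$ let $\overline{\alpha_i}\in\mathcal{MCG}(\mathbb{S}^2,n)$ be the image of $\alpha_i\in B_n(\mathbb{S}^2)$, where $\alpha_0=\sigma_1\cdots\sigma_{n-2}\sigma_{n-1}$, $\alpha_1=\sigma_1\cdots\sigma_{n-2}\sigma_{n-1}^2$, $\alpha_2=\sigma_1\cdots\sigma_{n-3}\sigma_{n-2}^2$ (so $\alpha_2=\sigma_1^2$ if $n=3$). Write $\langle\langle x\rangle\rangle$ for the normal closure of $x$ in $\mathcal{MCG}(\mathbb{S}^2,n)$. (a) If $n\ge 3$ is odd then $\langle\langle\overline{\alpha_1}\rangle\rangle=\mathcal{MCG}(\mathbb{S}^2,n)$. In particular, $\mathcal{MCG}(\mathbb{S}^2,n)$ is strongly $(n-1)$-torsion generated. (b) If $n\ge 4$ is even, there is no torsion element in $\mathcal{MCG}(\mathbb{S}^2,n)$ whose normal closure is equal to $\mathcal{MCG}(\mathbb{S}^2,n)$. Further, the quotient $\mathcal{MCG}(\mathbb{S}^2,n)/\langle\langle\overline{\alpha_1}\rangle\rangle$ is isomorphic to $\mathbb{Z}_2$. (c) For all $n\ge 3$ and for $i=0,2$, the quotient $\mathcal{MCG}(\mathbb{S}^2,n)/\langle\langle\overline{\alpha_i}\rangle\rangle$ is isomorphic to $\mathbb{Z}_{n-1}$, unless $n=3$ and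 $i=2$, in which case $\mathcal{MCG}(\mathbb{S}^2,3)/\langle\langle\overline{\alpha_2}\rangle\rangle\cong\mathcal{MCG}(\mathbb{S}^2,3)\cong S_3$.
   Context: $\mathcal{MCG}(\mathbb{S}^2,n)$ is the group of isotopy classes of orientation-preserving homeomorphisms of $\mathbb{S}^2$ leaving a given $n$-point set $X$ invariant, with isotopies fixing $X$ pointwise. It is identified with the quotient of the sphere braid group $B_n(\mathbb{S}^2)$ by the subgroup generated by the full twist $\Delta_n^2=(\sigma_1\cdots\sigma_{n-1})^n$ (which is central of order $2$). The sphere braid group $B_n(\mathbb{S}^2)=\pi_1(F_n(\mathbb{S}^2)/S_n)$, where $F_n(\mathbb{S}^2)$ is the space of ordered $n$-tuples of distinct points of $\mathbb{S}^2$, is generated by $\sigma_1,\dots,\sigma_{n-1}$ subject to $\sigma_i\sigma_j=\sigma_j\sigma_i$ if $|i-j|\ge 2$, $\sigma_i\sigma_{i+1}\sigma_i=\sigma_{i+1}\sigma_i\sigma_{i+1}$ for $1\le i\le n-2$, and $\sigma_1\cdots\sigma_{n-2}\sigma_{n-1}^2\sigma_{n-2}\cdots\sigma_1=1$. For $k\ge2$, a group $\Gamma$ is strongly $k$-torsion generated if there is an element of $\Gamma$ of order $k$ whose normal closure is $\Gamma$. A torsion element is an element of finite order. *)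

theory Defs
  imports "HOL-Algebra.Sym_Groups" "HOL-Homology.Homology"
begin

section \<open>Groups given by generators and relations\<close>

text \<open>A word over \<open>S\<close> is a list of letters \<open>(a, True)\<close>, standing for \<open>a\<close>, and \<open>(a, False)\<close>,
  standing for the inverse of \<open>a\<close>. A relation \<open>u = v\<close> is encoded as the pair \<open>(u, v)\<close>.\<close>

type_synonym 'a word = "('a \<times> bool) list"

inductive pres_eq :: "'a set \<Rightarrow> ('a word \<times> 'a word) set \<Rightarrow> 'a word \<Rightarrow> 'a word \<Rightarrow> bool"
  for S :: "'a set" and R :: "('a word \<times> 'a word) set"
where
  refl: "w \<in> lists (S \<times> UNIV) \<Longrightarrow> pres_eq S R w w"
| sym: "pres_eq S R u v \<Longrightarrow> pres_eq S R v u"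
| trans: "pres_eq S R u v \<Longrightarrow> pres_eq S R v w \<Longrightarrow> pres_eq S R u w"
| cong: "pres_eq S R u v \<Longrightarrow> x \<in> lists (S \<times> UNIV) \<Longrightarrow> y \<in> lists (S \<times> UNIV)
    \<Longrightarrow> pres_eq S R (x @ u @ y) (x @ v @ y)"
| cancel: "a \<in> S \<Longrightarrow> pres_eq S R [(a, b), (a, \<not> b)] []"
| rel: "(u, v) \<in> R \<Longrightarrow> u \<in> lists (S \<times> UNIV) \<Longrightarrow> v \<in> lists (S \<times> UNIV) \<Longrightarrow> pres_eq S R u v"

definition pres_class :: "'a set \<Rightarrow> ('a word \<times> 'a word) set \<Rightarrow> 'a word \<Rightarrow> 'a word set" where
  "pres_class S R w = {v. pres_eq S R w v}"

definition presented_group :: "'a set \<Rightarrow> ('a word \<times> 'a word) set \<Rightarrow> 'a word set monoid" where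
  "presented_group S R =
     \<lparr> carrier = pres_class S R ` lists (S \<times> UNIV),
       monoid.mult = (\<lambda>A B. \<Union>u\<in>A. \<Union>v\<in>B. pres_class S R (u @ v)),
       one = pres_class S R [] \<rparr>"


section \<open>The sphere braid group\<close>

text \<open>\<open>sigma_word [i, j, \<dots>]\<close> is the positive word \<open>\<sigma>\<^sub>i \<sigma>\<^sub>j \<dots>\<close>; the generators are indexed by
  \<open>{1..<n}\<close>, and the list \<open>[1..<n]\<close> is \<open>1, \<dots>, n - 1\<close>.\<close>

definition sigma_word :: "nat list \<Rightarrow> nat word" where
  "sigma_word is = map (\<lambda>i. (i, True)) is"

definition sphere_braid_rels :: "nat \<Rightarrow> (nat word \<times> nat word) set" where
  "sphere_braid_rels n =
     {(sigma_word [i, j], sigma_word [j, i]) | i j.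
        i \<in> {1..<n} \<and> j \<in> {1..<n} \<and> (i + 2 \<le> j \<or> j + 2 \<le> i)}
   \<union> {(sigma_word [i, i + 1, i], sigma_word [i + 1, i, i + 1]) | i. 1 \<le> i \<and> i + 2 \<le> n}
   \<union> {(sigma_word ([1..<n] @ rev [1..<n]), [])}"

definition sphere_braid_group :: "nat \<Rightarrow> nat word set monoid" where
  "sphere_braid_group n = presented_group {1..<n} (sphere_braid_rels n)"

definition sphere_braid :: "nat \<Rightarrow> nat list \<Rightarrow> nat word set" where
  "sphere_braid n is = pres_class {1..<n} (sphere_braid_rels n) (sigma_word is)"

text \<open>The elements \<open>\<alpha>\<^sub>0\<close>, \<open>\<alpha>\<^sub>1\<close>, \<open>\<alpha>\<^sub>2\<close>; only the indices 0, 1, 2 are meaningful.\<close>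

definition sphere_alpha :: "nat \<Rightarrow> nat \<Rightarrow> nat word set" where
  "sphere_alpha n i =
     (if i = 0 then sphere_braid n [1..<n]
      else if i = 1 then sphere_braid n ([1..<n] @ [n - 1])
      else sphere_braid n ([1..<n - 1] @ [n - 2]))"

definition sphere_full_twist :: "nat \<Rightarrow> nat word set" where
  "sphere_full_twist n = sphere_braid n [1..<n] [^]\<^bsub>sphere_braid_group n\<^esub> n"


section \<open>The mapping class group of the sphere with marked points\<close>

text \<open>The algebraic model: the sphere braid group modulo the subgroup generated by the full twist,
  which is central. \<open>braid_mcg_alpha n i\<close> is the image of \<open>\<alpha>\<^sub>i\<close>.\<close>

definition twist_subgroup :: "nat \<Rightarrow> nat word set set" where
  "twist_subgroup n = generate (sphere_braid_group n) {sphere_full_twist n}"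

definition braid_mcg :: "nat \<Rightarrow> nat word set set monoid" where
  "braid_mcg n = sphere_braid_group n Mod twist_subgroup n"

definition braid_mcg_alpha :: "nat \<Rightarrow> nat \<Rightarrow> nat word set set" where
  "braid_mcg_alpha n i = twist_subgroup n #>\<^bsub>sphere_braid_group n\<^esub> sphere_alpha n i"

text \<open>The geometric group. \<open>nsphere 2\<close> is the unit sphere of \<open>\<real>\<^sup>3\<close>, and a self-homeomorphism is
  orientation-preserving iff it has Brouwer degree 1. Maps are made extensional so that they are
  determined by their values on the sphere.\<close>

definition sphere_homeo_group :: "(nat \<Rightarrow> real) set \<Rightarrow> ((nat \<Rightarrow> real) \<Rightarrow> (nat \<Rightarrow> real)) monoid" where
  "sphere_homeo_group P =
     \<lparr> carrier = {f \<in> extensional (topspace (nsphere 2)).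
          homeomorphic_map (nsphere 2) (nsphere 2) f \<and> Brouwer_degree2 2 f = 1 \<and> f ` P = P},
       monoid.mult = FuncSet.compose (topspace (nsphere 2)),
       one = (\<lambda>x\<in>topspace (nsphere 2). x) \<rparr>"

text \<open>Isotopies are homotopies through homeomorphisms which are constant on \<open>P\<close>.\<close>

definition isotopic_rel ::
  "(nat \<Rightarrow> real) set \<Rightarrow> ((nat \<Rightarrow> real) \<Rightarrow> (nat \<Rightarrow> real)) \<Rightarrow> ((nat \<Rightarrow> real) \<Rightarrow> (nat \<Rightarrow> real)) \<Rightarrow> bool"
where
  "isotopic_rel P f g \<longleftrightarrow>
     homotopic_with (\<lambda>h. homeomorphic_map (nsphere 2) (nsphere 2) h \<and> (\<forall>x\<in>P. h x = f x))
       (nsphere 2) (nsphere 2) f g"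

text \<open>The cosets of the normal subgroup of homeomorphisms isotopic to the identity are exactly the
  isotopy classes.\<close>

definition sphere_mcg :: "(nat \<Rightarrow> real) set \<Rightarrow> ((nat \<Rightarrow> real) \<Rightarrow> (nat \<Rightarrow> real)) set monoid" where
  "sphere_mcg P =
     sphere_homeo_group P Mod
       {f \<in> carrier (sphere_homeo_group P). isotopic_rel P \<one>\<^bsub>sphere_homeo_group P\<^esub> f}"


section \<open>Normal closures and torsion generation\<close>

definition normal_closure :: "('a, 'b) monoid_scheme \<Rightarrow> 'a \<Rightarrow> 'a set" where
  "normal_closure G x = \<Inter>{N. N \<lhd> G \<and> x \<in> N}"

definition torsion_element :: "('a, 'b) monoid_scheme \<Rightarrow> 'a \<Rightarrow> bool" where
  "torsion_element G x \<longleftrightarrow> x \<in> carrier G \<and> (\<exists>k::nat. k > 0 \<and> x [^]\<^bsub>G\<^esub> k = \<one>\<^bsub>G\<^esub>)"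

text \<open>\<open>group.ord\<close> is 0 on elements of infinite order.\<close>

definition strongly_torsion_generated :: "('a, 'b) monoid_scheme \<Rightarrow> nat \<Rightarrow> bool" where
  "strongly_torsion_generated G k \<longleftrightarrow>
     k \<ge> 2 \<and> (\<exists>x\<in>carrier G. group.ord G x = k \<and> normal_closure G x = carrier G)"

end

theory Submission
  imports Defs "HOL-Number_Theory.Cong"
begin

text \<open>Write \<open>G\<close> for the mapping class group, \<open>\<sigma>\<^sub>i\<close> for the images of the braid generators in \<open>G\<close>, and
  \<open>e\<close> for the exponent sum of a braid word.

  \<^emph>\<open>The quotients.\<close> Conjugation by \<open>\<alpha>\<^sub>0\<close> sends \<open>\<sigma>\<^sub>i\<close> to \<open>\<sigma>\<^sub>i\<^sub>+\<^sub>1\<close>, and \<open>\<alpha>\<^sub>1\<close>, \<open>\<alpha>\<^sub>2\<close> do the same for all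
  but the last few indices. When \<open>\<alpha>\<^sub>i\<close> is killed, most generators therefore become equal. Each of the
  others commutes with a neighbour to which it is tied by the braid relation, and two commuting
  elements with \<open>aba = bab\<close> are equal. So the quotient is cyclic, generated by \<open>\<sigma>\<^sub>1\<close>, and the relators give
  an upper bound for its order: \<open>n - 1\<close> for \<open>\<alpha>\<^sub>0\<close> and, if \<open>n \<ge> 4\<close>, for \<open>\<alpha>\<^sub>2\<close>, and \<open>gcd n (2 (n - 1))\<close> for \<open>\<alpha>\<^sub>1\<close>.
  The bound is attained because \<open>e\<close> is well defined modulo every common divisor of \<open>2 (n - 1)\<close>
  and \<open>n (n - 1)\<close>, the exponent sums of the sphere relator and of the full twist
  (\<open>Mod_normal_closure_cyclic\<close>). The same homomorphism to \<open>\<int>/(n - 1)\<close> shows that the order of \<open>\<alpha>\<^sub>1\<close>,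
  a divisor of \<open>n - 1\<close> since \<open>\<alpha>\<^sub>1\<close> to the power \<open>n - 1\<close> is the full twist, is not smaller.

  \<^emph>\<open>Torsion for even \<open>n\<close>.\<close> For a braid word \<open>w\<close> let
  \<open>c p q\<close> be the signed number of crossings of the strands \<open>p\<close> and \<open>q\<close>. The sphere relator and the full
  twist change \<open>c\<close> only by functions of the form \<open>t p + t q\<close>. If \<open>n\<close> is even, a power of \<open>w\<close> is trivial in \<open>G\<close> and \<open>w\<close>
  fixes three strands \<open>x, y, z\<close>, averaging over the powers of \<open>w\<close> gives
  \<open>e = (n - 1) (S - (n - 2)/2 (c x y + c x z - c y z))\<close>, where \<open>S\<close> is the sum of all \<open>c x q\<close>; moreover
  \<open>S\<close> and the three crossing numbers are even. So \<open>e\<close> is even and divisible by \<open>n - 1\<close>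
  (\<open>periodic_word_three_fixed_strands\<close>).

  Suppose that \<open>x\<close> is a torsion element whose normal closure is \<open>G\<close>. Then \<open>e x\<close> is odd and prime to
  \<open>n - 1\<close>, since otherwise some homomorphism \<open>e mod p\<close> kills \<open>x\<close> but not \<open>\<sigma>\<^sub>1\<close>. Take an odd prime \<open>p\<close>
  dividing \<open>n - 1\<close>, and powers \<open>z\<close> and \<open>y\<close> of \<open>x\<close> of \<open>p\<close>-power order with \<open>e z\<close> prime to \<open>p\<close>, and of
  \<open>2\<close>-power order with \<open>e y\<close> odd. By the formula both fix at most two marked points. Counting modulo \<open>p\<close>,
  \<open>z\<close> fixes exactly one point; counting modulo \<open>2\<close>, \<open>y\<close> fixes none or two. As \<open>y\<close> and \<open>z\<close> commute, \<open>y\<close>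
  fixes the point of \<open>z\<close>, hence exactly one further point, and \<open>z\<close> fixes that point as well: a
  contradiction (\<open>periodic_word_exponent\<close>).

  \<^emph>\<open>Three points and the geometric group.\<close> For \<open>n = 3\<close> the relations force \<open>\<sigma>\<^sub>i\<^sup>2 = 1\<close>, which leaves at
  most six elements, while \<open>G\<close> maps onto \<open>S\<^sub>3\<close>. All the assertions are invariant under isomorphism, so they
  pass to every group isomorphic to \<open>G\<close>.\<close>

section \<open>Elements satisfying the braid relations\<close>

text \<open>Simplification with associativity brackets products to the right and so hides a known product
  \<open>x \<otimes> y\<close> of the first two factors. This form of the hypothesis applies to the bracketed term.\<close>

lemma (in monoid) swap_left:
  assumes "x \<otimes> y = z \<otimes> w" "x \<in> carrier G" "y \<in> carrier G" "z \<in> carrier G" "w \<in> carrier G"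
    "u \<in> carrier G"
  shows "x \<otimes> (y \<otimes> u) = z \<otimes> (w \<otimes> u)"
  using assms by (metis m_assoc)

locale braid_system = group G for G :: "('a, 'b) monoid_scheme" (structure) +
  fixes n :: nat and s :: "nat \<Rightarrow> 'a"
  assumes gen_closed [simp]: "\<lbrakk>1 \<le> i; i < n\<rbrakk> \<Longrightarrow> s i \<in> carrier G"
    and far_commute: "\<lbrakk>1 \<le> i; i + 2 \<le> j; j < n\<rbrakk> \<Longrightarrow> s i \<otimes> s j = s j \<otimes> s i"
    and braid: "\<lbrakk>1 \<le> i; i + 1 < n\<rbrakk> \<Longrightarrow> s i \<otimes> (s (i + 1) \<otimes> s i) = s (i + 1) \<otimes> (s i \<otimes> s (i + 1))"
begin

definition word :: "nat list \<Rightarrow> 'a" where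
  "word is = foldr (\<lambda>i x. s i \<otimes> x) is \<one>"

lemma word_Nil [simp]: "word [] = \<one>"
  and word_Cons [simp]: "word (i # is) = s i \<otimes> word is"
  by (simp_all add: word_def)

lemma word_closed [simp]: "set is \<subseteq> {1..<n} \<Longrightarrow> word is \<in> carrier G"
  by (induction "is") auto

lemma word_append:
  "\<lbrakk>set is \<subseteq> {1..<n}; set js \<subseteq> {1..<n}\<rbrakk> \<Longrightarrow> word (is @ js) = word is \<otimes> word js"
  by (induction "is") (auto simp: m_assoc)

text \<open>\<open>rot k\<close> and \<open>rot1 k\<close> are the elements \<open>\<alpha>\<^sub>0\<close> and \<open>\<alpha>\<^sub>1\<close> for the first \<open>k\<close> strands: geometrically
  rotations of the disc with no and with one marked point at the centre. So \<open>\<alpha>\<^sub>0\<close>, \<open>\<alpha>\<^sub>1\<close>, \<open>\<alpha>\<^sub>2\<close>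
  are \<open>rot n\<close>, \<open>rot1 n\<close> and \<open>rot1 (n - 1)\<close>.\<close>

definition rot :: "nat \<Rightarrow> 'a" where "rot k = word [1..<k]"

abbreviation rot1 :: "nat \<Rightarrow> 'a" where "rot1 k \<equiv> rot k \<otimes> s (k - 1)"

lemma rot_closed [simp]: "k \<le> n \<Longrightarrow> rot k \<in> carrier G"
  unfolding rot_def by (rule word_closed) auto

lemma rot_1 [simp]: "rot (Suc 0) = \<one>"
  by (simp add: rot_def)

lemma rot_Suc: "\<lbrakk>1 \<le> k; k < n\<rbrakk> \<Longrightarrow> rot (Suc k) = rot k \<otimes> s k"
  using word_append[of "[1..<k]" "[k]"] by (auto simp: rot_def)

lemma rot_commute: "\<lbrakk>1 \<le> k; k < i; i < n\<rbrakk> \<Longrightarrow> s i \<otimes> rot k = rot k \<otimes> s i"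
proof (induction k rule: nat_induct_at_least)
  case (Suc k)
  have "s i \<otimes> rot (Suc k) = s i \<otimes> (rot k \<otimes> s k)"
    using Suc by (simp add: rot_Suc)
  also have "\<dots> = rot k \<otimes> (s i \<otimes> s k)"
    using Suc by (intro swap_left) auto
  also have "\<dots> = rot k \<otimes> (s k \<otimes> s i)"
    using Suc far_commute[of k i] by (simp add: m_assoc)
  finally show ?case using Suc by (simp add: rot_Suc m_assoc)
qed simp

text \<open>Moving \<open>s i\<close> through the product from the right, it commutes with every factor until it meets
  \<open>s i \<otimes> s (i + 1)\<close>; there the braid relation turns it into \<open>s (i + 1)\<close>, which commutes with the rest.\<close>

lemma rot_shift:
  assumes "1 \<le> i" "i + 1 < k" "k \<le> n"
  shows "rot k \<otimes> s i = s (i + 1) \<otimes> rot k"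
  using assms(2,3)
proof (induction k)
  case (Suc k)
  show ?case
  proof (cases "i + 1 < k")
    case True
    then have "rot (Suc k) \<otimes> s i = (rot k \<otimes> s i) \<otimes> s k"
      using Suc.prems assms far_commute[of i k] by (simp add: rot_Suc m_assoc)
    also have "\<dots> = s (i + 1) \<otimes> rot (Suc k)"
      using True Suc assms by (simp add: rot_Suc m_assoc)
    finally show ?thesis .
  next
    case False
    with Suc.prems have k: "k = i + 1" by simp
    have "rot (Suc k) \<otimes> s i = rot i \<otimes> (s i \<otimes> (s (i + 1) \<otimes> s i))"
      using k assms Suc.prems by (simp add: rot_Suc m_assoc)
    also have "\<dots> = (rot i \<otimes> s (i + 1)) \<otimes> (s i \<otimes> s (i + 1))"
      using k assms Suc.prems braid[of i] by (simp add: m_assoc)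
    also have "\<dots> = s (i + 1) \<otimes> rot i \<otimes> (s i \<otimes> s (i + 1))"
      using k assms Suc.prems rot_commute[of i "i + 1"] by simp
    also have "\<dots> = s (i + 1) \<otimes> rot (Suc k)"
      using k assms Suc.prems by (simp add: rot_Suc m_assoc)
    finally show ?thesis .
  qed
qed simp

lemma rot1_shift:
  assumes "1 \<le> i" "i + 2 < k" "k \<le> n"
  shows "rot1 k \<otimes> s i = s (i + 1) \<otimes> rot1 k"
proof -
  have "rot1 k \<otimes> s i = (rot k \<otimes> s i) \<otimes> s (k - 1)"
    using assms far_commute[of i "k - 1"] by (simp add: m_assoc)
  then show ?thesis
    using assms rot_shift[of i k] by (simp add: m_assoc)
qed

lemma rot_pow_shift:
  assumes "1 \<le> i" "i + m < n"
  shows "rot n [^] m \<otimes> s i = s (i + m) \<otimes> rot n [^] m"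
  using assms(2)
proof (induction m)
  case (Suc m)
  have p: "rot n [^] Suc m = rot n \<otimes> rot n [^] m"
    by (rule nat_pow_Suc2) simp
  have "rot n [^] Suc m \<otimes> s i = rot n \<otimes> (rot n [^] m \<otimes> s i)"
    unfolding p using Suc.prems assms by (simp add: m_assoc)
  also have "\<dots> = (rot n \<otimes> s (i + m)) \<otimes> rot n [^] m"
    using Suc assms by (simp add: m_assoc)
  also have "\<dots> = s (i + Suc m) \<otimes> rot n \<otimes> rot n [^] m"
    using Suc.prems assms rot_shift[of "i + m" n] by simp
  also have "\<dots> = s (i + Suc m) \<otimes> rot n [^] Suc m"
    unfolding p using Suc.prems assms by (simp add: m_assoc)
  finally show ?case .
qed (use assms in simp)

text \<open>The shift \<open>rot_shift\<close> closes up to a cycle of length \<open>n\<close> in which the missing generator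
  \<open>s n\<close> is replaced by a step of length two from \<open>s (n - 1)\<close> to \<open>s 1\<close>. The reason is that \<open>rot n\<close> shifts
  the whole word \<open>s 1 \<otimes> \<dots> \<otimes> s (n - 2)\<close>, and that \<open>rot n\<close> both starts with \<open>s 1\<close> and ends with \<open>s (n - 1)\<close>.\<close>

lemma rot_sq_last:
  assumes "2 \<le> n"
  shows "rot n \<otimes> rot n \<otimes> s (n - 1) = s 1 \<otimes> (rot n \<otimes> rot n)"
proof -
  define tail where "tail k = word [2..<Suc k]" for k
  have tail_Suc: "tail (Suc k) = tail k \<otimes> s (Suc k)" if "1 \<le> k" "Suc k < n" for k
  proof -
    have "[2..<Suc (Suc k)] = [2..<Suc k] @ [Suc k]" using that by simp
    moreover have "word ([2..<Suc k] @ [Suc k]) = word [2..<Suc k] \<otimes> word [Suc k]"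
      by (rule word_append) (use that in auto)
    moreover have "word [Suc k] = s (Suc k)" using that by simp
    ultimately show ?thesis unfolding tail_def by (simp only:)
  qed
  have tail_closed: "tail k \<in> carrier G" if "k < n" for k
    unfolding tail_def using that by (intro word_closed) auto
  have shift: "rot n \<otimes> rot k = tail k \<otimes> rot n" if "1 \<le> k" "k < n" for k
    using that
  proof (induction k rule: nat_induct_at_least)
    case base
    then show ?case by (simp add: tail_def)
  next
    case (Suc k)
    have "rot n \<otimes> rot (Suc k) = (rot n \<otimes> rot k) \<otimes> s k"
      using Suc.hyps Suc.prems by (simp add: rot_Suc m_assoc)
    also have "\<dots> = (tail k \<otimes> rot n) \<otimes> s k"
      using Suc by simp
    also have "\<dots> = tail k \<otimes> (rot n \<otimes> s k)"
      using Suc tail_closed by (simp add: m_assoc)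
    also have "\<dots> = tail (Suc k) \<otimes> rot n"
      using Suc rot_shift[of k n] tail_closed by (simp add: tail_Suc m_assoc)
    finally show ?case .
  qed
  have c: "tail (n - 1) \<in> carrier G" using assms by (simp add: tail_closed)
  have first: "rot n = s 1 \<otimes> tail (n - 1)"
    using assms by (simp add: tail_def rot_def upt_conv_Cons numeral_2_eq_2)
  have last: "rot n = rot (n - 1) \<otimes> s (n - 1)"
    using rot_Suc[of "n - 1"] assms by simp
  have eq: "tail (n - 1) \<otimes> rot n = rot n \<otimes> rot (n - 1)"
    using shift[of "n - 1"] assms by simp
  have "rot n \<otimes> rot n \<otimes> s (n - 1) = (s 1 \<otimes> (tail (n - 1) \<otimes> rot n)) \<otimes> s (n - 1)"
    using c assms by (subst first) (simp add: m_assoc)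
  also have "\<dots> = s 1 \<otimes> (rot n \<otimes> (rot (n - 1) \<otimes> s (n - 1)))"
    unfolding eq using assms by (simp add: m_assoc)
  finally show ?thesis using last by simp
qed

text \<open>Conjugation by \<open>rot n\<close> runs once around the cycle \<open>s i, \<dots>, s (n - 1), *, s 1, \<dots>, s i\<close>.\<close>

lemma full_twist_commute:
  assumes "1 \<le> i" "i < n" 
  shows "rot n [^] n \<otimes> s i = s i \<otimes> rot n [^] n"
proof -
  define d where "d = rot n"
  have d: "d \<in> carrier G" and s: "\<And>j. \<lbrakk>1 \<le> j; j < n\<rbrakk> \<Longrightarrow> s j \<in> carrier G" by (simp_all add: d_def)
  \<comment> \<open>The \<open>n\<close> steps: \<open>n - 1 - i\<close> up to the last generator, two to the first, \<open>i - 1\<close> back to \<open>s i\<close>.\<close>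
  have d2: "d [^] Suc (Suc m) = d \<otimes> d \<otimes> d [^] m" for m :: nat
    using d nat_pow_Suc2 by (simp add: m_assoc del: nat_pow_Suc)
  have "i - 1 + Suc (Suc (n - 1 - i)) = n" using assms by simp
  then have split: "d [^] n = d [^] (i - 1) \<otimes> (d \<otimes> d \<otimes> d [^] (n - 1 - i))"
    unfolding d2[symmetric] using d by (metis nat_pow_mult)
  have "d [^] n \<otimes> s i = d [^] (i - 1) \<otimes> (d \<otimes> d \<otimes> (d [^] (n - 1 - i) \<otimes> s i))"
    unfolding split using s assms d by (simp add: m_assoc)
  also have "d [^] (n - 1 - i) \<otimes> s i = s (n - 1) \<otimes> d [^] (n - 1 - i)"
    using rot_pow_shift[of i "n - 1 - i"] assms by (simp add: d_def)
  also have "d \<otimes> d \<otimes> (s (n - 1) \<otimes> d [^] (n - 1 - i)) = s 1 \<otimes> (d \<otimes> d \<otimes> d [^] (n - 1 - i))"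
    using rot_sq_last assms d s[of 1] s[of "n - 1"] by (intro swap_left) (auto simp: d_def)
  also have "d [^] (i - 1) \<otimes> (s 1 \<otimes> (d \<otimes> d \<otimes> d [^] (n - 1 - i))) =
      s i \<otimes> (d [^] (i - 1) \<otimes> (d \<otimes> d \<otimes> d [^] (n - 1 - i)))"
    using rot_pow_shift[of 1 "i - 1"] assms d s[of 1] s[of i]
    by (intro swap_left) (auto simp: d_def)
  also have "\<dots> = s i \<otimes> d [^] n"
    unfolding split ..
  finally show ?thesis by (simp add: d_def)
qed

text \<open>Each further factor \<open>s (n - 1)\<close> of \<open>rot1 n\<close> is pushed to the right of the accumulated power of \<open>rot n\<close>,
  where it arrives as the generator that extends the remaining word on the left by one letter. For \<open>m = n - 1\<close> that word
  is \<open>rot n\<close> itself.\<close>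

lemma rot1_pow:
  assumes "m < n"
  shows "rot1 n [^] m = rot n [^] m \<otimes> word [n - m..<n]"
  using assms
proof (induction m)
  case (Suc m)
  have e: "rot1 n \<in> carrier G" and l: "s (n - 1) \<in> carrier G" using Suc by auto
  have w: "word [n - m..<n] \<in> carrier G" using Suc by (intro word_closed) auto
  have i: "n - Suc m + m = n - 1" "n - m = Suc (n - Suc m)" using Suc by auto
  have p: "x [^] Suc m = x \<otimes> x [^] m" if "x \<in> carrier G" for x
    by (rule nat_pow_Suc2) fact
  have "rot1 n [^] Suc m = rot n \<otimes> ((s (n - 1) \<otimes> rot n [^] m) \<otimes> word [n - m..<n])"
    unfolding p[OF e] using e Suc w l by (simp add: m_assoc)
  also have "s (n - 1) \<otimes> rot n [^] m = rot n [^] m \<otimes> s (n - Suc m)"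
    using rot_pow_shift[of "n - Suc m" m] Suc i(1) by auto
  also have "rot n \<otimes> (rot n [^] m \<otimes> s (n - Suc m) \<otimes> word [n - m..<n]) =
      rot n [^] Suc m \<otimes> word [n - Suc m..<n]"
    unfolding p[OF rot_closed[OF order_refl]]
    using Suc w i(2) by (simp add: m_assoc upt_conv_Cons[of "n - Suc m"])
  finally show ?case .
qed simp

lemma rot1_pow_full_twist:
  assumes "2 \<le> n"
  shows "rot1 n [^] (n - 1) = rot n [^] n"
proof -
  have "rot n [^] (n - 1) \<otimes> word [1..<n] = rot n [^] n"
    unfolding rot_def[symmetric] using assms nat_pow_Suc[of "rot n" "n - 1"] by (simp del: nat_pow_Suc)
  then show ?thesis using rot1_pow[of "n - 1"] assms by simp
qed

lemma commuting_neighbours_eq: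
  assumes "1 \<le> i" "i + 1 < n" "s i \<otimes> s (i + 1) = s (i + 1) \<otimes> s i"
  shows "s i = s (i + 1)"
proof -
  have "(s (i + 1) \<otimes> s i) \<otimes> s i = (s (i + 1) \<otimes> s i) \<otimes> s (i + 1)"
    using assms braid[of i] by (metis add_lessD1 gen_closed le_add1 le_add2 m_assoc trans_le_add1)
  then show ?thesis using assms by simp
qed

lemma rot_eq_one_imp:
  assumes "rot n = \<one>" "1 \<le> i" "i < n"
  shows "s i = s 1"
  using assms(2,3)
proof (induction i rule: nat_induct_at_least)
  case (Suc i)
  then show ?case using rot_shift[of i n] assms(1) by simp
qed simp

text \<open>The shift identifies all generators below \<open>s (k - 1)\<close>. If \<open>k \<ge> 4\<close>, the last one commutes with
  \<open>s 1 = s (k - 2)\<close>; if \<open>k = 3\<close>, it commutes with \<open>s 1\<close> because \<open>s 1\<close> is the inverse of its square. In both cases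
  it equals its neighbour.\<close>

lemma rot1_eq_one_imp:
  assumes "rot1 k = \<one>" "3 \<le> k" "k \<le> n" "1 \<le> i" "i < k"
  shows "s i = s 1"
proof -
  have low: "s j = s 1" if "1 \<le> j" "j + 1 < k" for j
    using that
  proof (induction j rule: nat_induct_at_least)
    case (Suc j)
    then show ?case using rot1_shift[of j k] assms by simp
  qed simp
  have "s (k - 2) \<otimes> s (k - 1) = s (k - 1) \<otimes> s (k - 2)"
  proof (cases "k = 3")
    case True
    then have w: "s 1 \<otimes> s 2 \<otimes> s 2 = \<one>" and c: "s 1 \<in> carrier G" "s 2 \<in> carrier G"
      using assms by (simp_all add: rot_def upt_conv_Cons numeral_2_eq_2)
    then have "s 1 = inv (s 2 \<otimes> s 2)"
      by (metis inv_equality m_assoc m_closed)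
    with c have "s 1 \<otimes> s 2 = s 2 \<otimes> s 1"
      by (simp add: inv_mult_group m_assoc[symmetric]) (simp add: m_assoc)
    with True show ?thesis by (simp add: numeral_2_eq_2)
  next
    case False
    then show ?thesis
      using low[of "k - 2"] far_commute[of 1 "k - 1"] assms by simp
  qed
  then have "s (k - 2) = s (k - 1)"
    using commuting_neighbours_eq[of "k - 2"] assms by (simp add: numeral_2_eq_2 Suc_diff_Suc)
  then show ?thesis
    using low[of i] low[of "k - 2"] assms by (cases "i = k - 1") auto
qed

lemma word_all_equal:
  assumes "\<And>i. i \<in> set is \<Longrightarrow> s i = x" "x \<in> carrier G"
  shows "word is = x [^] length is"
proof (use assms in \<open>induction "is"\<close>)
  case (Cons i "is")
  then show ?case using nat_pow_Suc2[of x "length is"] by (simp del: nat_pow_Suc)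
qed simp

end

section \<open>Normal closures and cyclic quotients\<close>

lemma (in group) normal_closure_normal:
  assumes "x \<in> carrier G"
  shows "normal_closure G x \<lhd> G"
proof -
  have top: "carrier G \<in> {N. N \<lhd> G \<and> x \<in> N}"
    using assms by (auto simp: normal_inv_iff subgroup_self)
  then have "subgroup (normal_closure G x) G"
    unfolding normal_closure_def by (intro subgroups_Inter) (auto simp: normal_inv_iff)
  then show ?thesis
    by (auto simp: normal_inv_iff normal_closure_def)
qed

lemma mem_normal_closure: "x \<in> normal_closure G x"
  by (simp add: normal_closure_def)

lemma normal_closure_least: "\<lbrakk>N \<lhd> G; x \<in> N\<rbrakk> \<Longrightarrow> normal_closure G x \<subseteq> N"
  by (auto simp: normal_closure_def)

lemma (in group_hom) normal_closure_subset_kernel: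
  "\<lbrakk>x \<in> carrier G; h x = \<one>\<^bsub>H\<^esub>\<rbrakk> \<Longrightarrow> normal_closure G x \<subseteq> kernel G H h"
  by (rule normal_closure_least[OF normal_kernel]) (simp add: kernel_def)

text \<open>If the classes of the powers of \<open>a\<close> exhaust the quotient by the normal closure of \<open>x\<close>
  and \<open>a [^] k\<close> lies in it, that quotient is cyclic of order at most \<open>k\<close>. The homomorphism \<open>h\<close>
  factors through it onto a group of order \<open>k\<close>.\<close>

lemma (in group) Mod_normal_closure_cyclic:
  fixes k :: nat
  assumes x: "x \<in> carrier G" and k: "k > 0"
    and h: "h \<in> hom G (integer_mod_group k)" "h x = 0"
    and a: "a \<in> carrier G" "h a = 1 mod int k"
    and gen: "\<And>y. y \<in> carrier G \<Longrightarrow> \<exists>j::int. normal_closure G x #> y = normal_closure G x #> (a [^] j)"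
    and ak: "a [^] k \<in> normal_closure G x"
  shows "G Mod normal_closure G x \<cong> integer_mod_group k"
proof -
  let ?Z = "integer_mod_group k" and ?N = "normal_closure G x"
  interpret h: group_hom G ?Z h
    using h(1) by (intro group_hom.intro group_hom_axioms.intro) auto
  have N: "subgroup ?N G" using normal_closure_normal[OF x] by (rule normal_imp_subgroup)
  have hpow: "h (a [^] j) = j mod int k" for j :: int
    using a by (simp add: h.hom_int_pow int_pow_integer_mod_group mod_mult_right_eq)
  have "y \<in> ?N" if y: "y \<in> kernel G ?Z h" for y
  proof -
    from y have yG: "y \<in> carrier G" "h y = 0" by (auto simp: kernel_def)
    then obtain j :: int where "?N #> y = ?N #> (a [^] j)" using gen by blast
    then have "y \<in> ?N #> (a [^] j)" using rcos_self[OF yG(1) N] by simp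
    then obtain m where m: "m \<in> ?N" "y = m \<otimes> a [^] j" by (auto simp: r_coset_def)
    then have "h m = 0" using h.normal_closure_subset_kernel[OF x] h(2) by (auto simp: kernel_def)
    then have "j mod int k = 0"
      using m yG subgroup.subset[OF N] a hpow[of j] by (auto simp: subset_iff)
    then obtain i where "j = int k * i" by auto
    then have "a [^] j = (a [^] k) [^] i"
      using a(1) by (simp add: int_pow_pow flip: int_pow_int)
    then show ?thesis
      using m subgroup.m_closed[OF N m(1)] subgroup_int_pow_closed[OF N ak] by simp
  qed
  then have "?N = kernel G ?Z h"
    using h.normal_closure_subset_kernel[OF x] h(2) by auto
  moreover have "h ` carrier G = carrier ?Z"
  proof
    show "carrier ?Z \<subseteq> h ` carrier G"
    proof
      fix z assume "z \<in> carrier ?Z"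
      then have "h (a [^] z) = z" using k by (simp add: hpow carrier_integer_mod_group)
      then show "z \<in> h ` carrier G" using a(1) by (metis image_eqI int_pow_closed)
    qed
  qed auto
  ultimately show ?thesis using h.FactGroup_iso by simp
qed

context braid_system
begin

lemma braid_system_image:
  assumes "group H" "h \<in> hom G H"
  shows "braid_system H n (h \<circ> s)"
proof -
  interpret h: group_hom G H h
    using assms by (simp add: group_hom_def group_hom_axioms_def)
  show ?thesis
  proof
    fix i j assume "1 \<le> i" "i + 2 \<le> j" "j < n"
    then show "(h \<circ> s) i \<otimes>\<^bsub>H\<^esub> (h \<circ> s) j = (h \<circ> s) j \<otimes>\<^bsub>H\<^esub> (h \<circ> s) i"
      using arg_cong[OF far_commute[of i j], of h] by simp
  next
    fix i assume "1 \<le> i" "i + 1 < n"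
    then show "(h \<circ> s) i \<otimes>\<^bsub>H\<^esub> ((h \<circ> s) (i + 1) \<otimes>\<^bsub>H\<^esub> (h \<circ> s) i) =
        (h \<circ> s) (i + 1) \<otimes>\<^bsub>H\<^esub> ((h \<circ> s) i \<otimes>\<^bsub>H\<^esub> (h \<circ> s) (i + 1))"
      using arg_cong[OF braid[of i], of h] by simp
  qed simp
qed

lemma word_image:
  assumes "group H" "h \<in> hom G H" "set is \<subseteq> {1..<n}"
  shows "braid_system.word H (h \<circ> s) is = h (word is)"
proof -
  interpret h: group_hom G H h
    using assms by (simp add: group_hom_def group_hom_axioms_def)
  interpret H: braid_system H n "h \<circ> s"
    using assms by (intro braid_system_image)
  show ?thesis
    using assms(3) by (induction "is") auto
qed

lemma rot_image:
  assumes "group H" "h \<in> hom G H" "k \<le> n"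
  shows "braid_system.rot H (h \<circ> s) k = h (rot k)"
proof -
  have "set [1..<k] \<subseteq> {1..<n}" using assms(3) by simp
  from word_image[OF assms(1,2) this] show ?thesis
    unfolding rot_def braid_system.rot_def[OF braid_system_image[OF assms(1,2)]] .
qed

lemma rot_all_equal:
  assumes "\<And>i. \<lbrakk>1 \<le> i; i < n\<rbrakk> \<Longrightarrow> s i = s 1" "1 < n" "k \<le> n"
  shows "rot k = s 1 [^] (k - 1)"
proof -
  have "word [1..<k] = s 1 [^] length [1..<k]"
  proof (rule word_all_equal)
    show "s i = s 1" if "i \<in> set [1..<k]" for i
      using assms(1)[of i] assms(3) that by simp
  qed (use assms(2) in simp)
  then show ?thesis by (simp add: rot_def)
qed

end

text \<open>The relations of the sphere braid group together with the triviality of the full twist, for a generating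
  family of a group. They pass to surjective images, so the mapping class group, its quotients and its isomorphic
  copies can be treated alike.\<close>

locale sphere_mcg_system = braid_system +
  assumes three_le: "3 \<le> n"
    and sphere_relation: "word ([1..<n] @ rev [1..<n]) = \<one>"
    and full_twist_trivial: "rot n [^] n = \<one>"
    and generated: "carrier G = generate G (s ` {1..<n})"
begin

end

lemma (in braid_system) sphere_mcg_system_image:
  assumes "group H" "h \<in> hom G H" "h ` carrier G = carrier H" "3 \<le> n"
    and sphere: "h (word ([1..<n] @ rev [1..<n])) = \<one>\<^bsub>H\<^esub>"
    and twist: "h (rot n [^] n) = \<one>\<^bsub>H\<^esub>"
    and generated: "carrier G = generate G (s ` {1..<n})"
  shows "sphere_mcg_system H n (h \<circ> s)"
proof -
  interpret h: group_hom G H h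
    using assms by (simp add: group_hom_def group_hom_axioms_def)
  interpret H: braid_system H n "h \<circ> s"
    using assms by (intro braid_system_image)
  show ?thesis
  proof
    show "H.word ([1..<n] @ rev [1..<n]) = \<one>\<^bsub>H\<^esub>"
      using word_image[OF assms(1,2), of "[1..<n] @ rev [1..<n]"] sphere by auto
    show "H.rot n [^]\<^bsub>H\<^esub> n = \<one>\<^bsub>H\<^esub>"
      using rot_image[OF assms(1,2), of n] twist h.hom_nat_pow[of "rot n" n] by simp
    have "s ` {1..<n} \<subseteq> carrier G" by auto
    then show "carrier H = generate H ((h \<circ> s) ` {1..<n})"
      using h.generate_img generated assms(3) by (metis image_comp)
  qed fact
qed

context sphere_mcg_system
begin

lemma sphere_mcg_system_onto:
  assumes "group H" "h \<in> hom G H" "h ` carrier G = carrier H"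
  shows "sphere_mcg_system H n (h \<circ> s)"
proof (rule sphere_mcg_system_image[OF assms three_le])
  interpret h: group_hom G H h
    using assms by (simp add: group_hom_def group_hom_axioms_def)
  show "h (word ([1..<n] @ rev [1..<n])) = \<one>\<^bsub>H\<^esub>" "h (rot n [^] n) = \<one>\<^bsub>H\<^esub>"
    using sphere_relation full_twist_trivial by simp_all
qed (rule generated)

lemma quotient_system:
  assumes "N \<lhd> G"
  shows "sphere_mcg_system (G Mod N) n ((\<lambda>y. N #> y) \<circ> s)"
  using normal.factorgroup_is_group[OF assms] normal.r_coset_hom_Mod[OF assms]
  by (intro sphere_mcg_system_onto) (auto simp: carrier_FactGroup)

lemma all_equal_imp_power:
  assumes "\<And>i. \<lbrakk>1 \<le> i; i < n\<rbrakk> \<Longrightarrow> s i = s 1" "y \<in> carrier G"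
  shows "\<exists>j::int. y = s 1 [^] j"
proof -
  have s1: "s 1 \<in> carrier G" using three_le by simp
  have "s ` {1..<n} \<subseteq> {s 1}"
  proof (rule image_subsetI)
    fix i assume "i \<in> {1..<n}"
    then show "s i \<in> {s 1}" using assms(1)[of i] by simp
  qed
  then have "y \<in> generate G {s 1}"
    using assms(2) generated mono_generate by blast
  then show ?thesis using generate_pow[OF s1] by auto
qed

lemma all_equal_imp_order:
  assumes "\<And>i. \<lbrakk>1 \<le> i; i < n\<rbrakk> \<Longrightarrow> s i = s 1"
  shows "s 1 [^] (2 * (n - 1)) = \<one>"
proof -
  have "word ([1..<n] @ rev [1..<n]) = s 1 [^] length ([1..<n] @ rev [1..<n])"
  proof (rule word_all_equal)
    show "s i = s 1" if "i \<in> set ([1..<n] @ rev [1..<n])" for i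
      using assms[of i] that by auto
  qed (use three_le in simp)
  then show ?thesis using sphere_relation by (simp add: mult_2)
qed

lemma rot_trivial_imp:
  assumes "rot n = \<one>"
  shows "1 \<le> i \<Longrightarrow> i < n \<Longrightarrow> s i = s 1" and "s 1 [^] (n - 1) = \<one>"
proof -
  show eq: "s i = s 1" if "1 \<le> i" "i < n" for i
    using rot_eq_one_imp[OF assms that] .
  show "s 1 [^] (n - 1) = \<one>"
    using rot_all_equal[OF eq, of n] assms three_le by simp
qed

text \<open>Once all generators are equal, \<open>rot1 n\<close> is \<open>s 1 [^] n\<close> and the sphere relator is
  \<open>s 1 [^] (2 * (n - 1))\<close>. As \<open>2 n - 2 (n - 1) = 2\<close>, the square of \<open>s 1\<close> is trivial, and for odd \<open>n\<close> so is
  \<open>s 1 [^] n = s 1\<close>.\<close>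

lemma rot1_trivial_imp:
  assumes "rot1 n = \<one>"
  shows "1 \<le> i \<Longrightarrow> i < n \<Longrightarrow> s i = s 1"
    and "s 1 [^] (2::nat) = \<one>"
    and "odd n \<Longrightarrow> s 1 = \<one>"
proof -
  have s1: "s 1 \<in> carrier G" using three_le by simp
  show eq: "s i = s 1" if "1 \<le> i" "i < n" for i
    using rot1_eq_one_imp[OF assms three_le order_refl that] .
  have "rot1 n = s 1 [^] (n - 1) \<otimes> s 1"
    using rot_all_equal[OF eq, of n] eq[of "n - 1"] three_le by simp
  also have "\<dots> = s 1 [^] n"
    using three_le nat_pow_Suc[of "s 1" "n - 1"] by (simp del: nat_pow_Suc)
  finally have n: "s 1 [^] n = \<one>" using assms by simp
  have "s 1 [^] (2 * (n - 1)) \<otimes> s 1 [^] (2::nat) = s 1 [^] (2 * (n - 1) + 2)"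
    using s1 by (rule nat_pow_mult)
  also have "2 * (n - 1) + 2 = n * 2" using three_le by simp
  also have "s 1 [^] (n * 2) = \<one>" using s1 n by (simp flip: nat_pow_pow)
  finally show sq: "s 1 [^] (2::nat) = \<one>"
    using all_equal_imp_order[OF eq] s1 by simp
  show "s 1 = \<one>" if odd: "odd n"
  proof -
    obtain m where m: "n = 2 * m + 1" using odd by (rule oddE)
    have "s 1 [^] (2 * m) = \<one>" using s1 sq by (simp flip: nat_pow_pow)
    then show ?thesis using n s1 unfolding m by (simp flip: nat_pow_mult)
  qed
qed

text \<open>The relation \<open>rot1 (n - 1) = \<one>\<close> only involves the generators below \<open>s (n - 1)\<close>. For
  \<open>n \<ge> 4\<close> the last generator commutes with \<open>s 1\<close>, hence with its neighbour \<open>s (n - 2) = s 1\<close>.\<close>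

lemma rot1_pred_trivial_imp:
  assumes "rot1 (n - 1) = \<one>" "4 \<le> n"
  shows "1 \<le> i \<Longrightarrow> i < n \<Longrightarrow> s i = s 1" and "s 1 [^] (n - 1) = \<one>"
proof -
  have low: "s i = s 1" if "1 \<le> i" "i < n - 1" for i
    using rot1_eq_one_imp[OF assms(1), of i] that assms(2) by simp
  have "s (n - 2) \<otimes> s (n - 1) = s (n - 1) \<otimes> s (n - 2)"
    using low[of "n - 2"] far_commute[of 1 "n - 1"] assms(2) by simp
  then have "s (n - 2) = s (n - 1)"
    using commuting_neighbours_eq[of "n - 2"] assms(2) by (simp add: numeral_2_eq_2 Suc_diff_Suc)
  then show eq: "s i = s 1" if "1 \<le> i" "i < n" for i
    using low[of i] low[of "n - 2"] that assms(2) by (cases "i = n - 1") simp_all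
  have "rot1 (n - 1) = s 1 [^] (n - 2) \<otimes> s 1"
    using rot_all_equal[OF eq, of "n - 1"] eq[of "n - 2"] assms(2) by (simp add: numeral_2_eq_2)
  also have "\<dots> = s 1 [^] (n - 1)"
    using assms(2) nat_pow_Suc[of "s 1" "n - 2"]
    by (simp add: numeral_2_eq_2 Suc_diff_Suc del: nat_pow_Suc)
  finally show "s 1 [^] (n - 1) = \<one>" using assms(1) by simp
qed

definition has_length_hom :: "nat \<Rightarrow> bool" where
  "has_length_hom k \<longleftrightarrow> 
     (\<exists>h \<in> hom G (integer_mod_group k). \<forall>i. 1 \<le> i \<longrightarrow> i < n \<longrightarrow> h (s i) = 1 mod int k)"

lemma length_hom_word:
  assumes h: "h \<in> hom G (integer_mod_group k)" 
    "\<And>i. \<lbrakk>1 \<le> i; i < n\<rbrakk> \<Longrightarrow> h (s i) = 1 mod int k"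
    and "set is \<subseteq> {1..<n}"
  shows "h (word is) = int (length is) mod int k"
proof -
  interpret h: group_hom G "integer_mod_group k" h
    using h(1) by (simp add: group_hom_def group_hom_axioms_def)
  show ?thesis
    using assms(3)
  proof (induction "is")
    case (Cons i "is")
    then show ?case using h(2)[of i] by (simp add: mod_add_eq)
  qed (use h.hom_one in simp)
qed

lemma length_hom_rot:
  assumes h: "h \<in> hom G (integer_mod_group k)" 
    "\<And>i. \<lbrakk>1 \<le> i; i < n\<rbrakk> \<Longrightarrow> h (s i) = 1 mod int k"
    and m: "1 \<le> m" "m \<le> n"
  shows "h (rot m) = (int m - 1) mod int k"
  using length_hom_word[OF h, of "[1..<m]"] m by (auto simp: rot_def of_nat_diff)

lemma length_hom_rot1:
  assumes h: "h \<in> hom G (integer_mod_group k)" 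
    "\<And>i. \<lbrakk>1 \<le> i; i < n\<rbrakk> \<Longrightarrow> h (s i) = 1 mod int k"
    and m: "2 \<le> m" "m \<le> n"
  shows "h (rot1 m) = int m mod int k"
proof -
  have "h (rot1 m) = h (rot m) \<otimes>\<^bsub>integer_mod_group k\<^esub> h (s (m - 1))"
    using m by (intro hom_mult[OF h(1)]) auto
  then show ?thesis
    using length_hom_rot[OF h, of m] h(2)[of "m - 1"] m by (simp add: mod_add_eq)
qed

lemma Mod_normal_closure_cyclic_if_collapses:
  assumes x: "x \<in> carrier G" and k: "k > 0"
    and h: "h \<in> hom G (integer_mod_group k)" 
      "\<And>i. \<lbrakk>1 \<le> i; i < n\<rbrakk> \<Longrightarrow> h (s i) = 1 mod int k" "h x = 0"
    and eq: "\<And>i. \<lbrakk>1 \<le> i; i < n\<rbrakk> \<Longrightarrow> normal_closure G x #> s i = normal_closure G x #> s 1"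
    and sk: "(normal_closure G x #> s 1) [^]\<^bsub>G Mod normal_closure G x\<^esub> k = normal_closure G x"
  shows "G Mod normal_closure G x \<cong> integer_mod_group k"
proof -
  let ?N = "normal_closure G x"
  interpret N: normal ?N G by (rule normal_closure_normal[OF x])
  interpret Q: sphere_mcg_system "G Mod ?N" n "(\<lambda>y. ?N #> y) \<circ> s"
    by (rule quotient_system[OF N.normal_axioms])
  have s1: "s 1 \<in> carrier G" using three_le by simp
  show ?thesis
  proof (rule Mod_normal_closure_cyclic[OF x k h(1,3) s1])
    show "h (s 1) = 1 mod int k" using h(2) three_le by simp
    show "\<exists>j::int. ?N #> y = ?N #> (s 1 [^] j)" if "y \<in> carrier G" for y
    proof -
      have "?N #> y \<in> carrier (G Mod ?N)" using that by (auto simp: carrier_FactGroup)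
      then obtain j :: int where "?N #> y = (?N #> s 1) [^]\<^bsub>G Mod ?N\<^esub> j"
        using Q.all_equal_imp_power[of "?N #> y"] eq unfolding comp_def by blast
      then show ?thesis using N.FactGroup_int_pow[OF s1] by auto
    qed
    have "?N #> (s 1 [^] k) = ?N" using sk N.FactGroup_pow[OF s1] by simp
    then show "s 1 [^] k \<in> ?N"
      using rcos_self[OF _ N.subgroup_axioms] s1 by (metis nat_pow_closed)
  qed
qed

lemma quotient_rot:
  assumes "N \<lhd> G" "m \<le> n"
  shows "braid_system.rot (G Mod N) ((\<lambda>y. N #> y) \<circ> s) m = N #> rot m"
  using rot_image[OF normal.factorgroup_is_group[OF assms(1)] normal.r_coset_hom_Mod[OF assms(1)] assms(2)] .

lemma coset_normal_closure:
  assumes "x \<in> carrier G"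
  shows "normal_closure G x #> x = normal_closure G x"
  using coset_join2[OF assms normal_imp_subgroup[OF normal_closure_normal[OF assms]] mem_normal_closure] .

lemma quotient_rot1:
  assumes "N \<lhd> G" "2 \<le> m" "m \<le> n"
  shows "braid_system.rot (G Mod N) ((\<lambda>y. N #> y) \<circ> s) m \<otimes>\<^bsub>G Mod N\<^esub> ((\<lambda>y. N #> y) \<circ> s) (m - 1)
    = N #> rot1 m"
  using quotient_rot[OF assms(1,3)] hom_mult[OF normal.r_coset_hom_Mod[OF assms(1)], of "rot m" "s (m - 1)"]
    assms(2,3) by simp

theorem Mod_rot:
  assumes "has_length_hom (n - 1)"
  shows "G Mod normal_closure G (rot n) \<cong> integer_mod_group (n - 1)"
proof -
  let ?N = "normal_closure G (rot n)"
  obtain h where h: "h \<in> hom G (integer_mod_group (n - 1))"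
    "\<And>i. \<lbrakk>1 \<le> i; i < n\<rbrakk> \<Longrightarrow> h (s i) = 1 mod int (n - 1)"
    using assms unfolding has_length_hom_def by blast
  have N: "?N \<lhd> G" by (intro normal_closure_normal) simp
  interpret Q: sphere_mcg_system "G Mod ?N" n "(\<lambda>y. ?N #> y) \<circ> s"
    by (rule quotient_system[OF N])
  have "Q.rot n = \<one>\<^bsub>G Mod ?N\<^esub>"
    using quotient_rot[OF N order_refl] coset_normal_closure[of "rot n"] by simp
  note Q = Q.rot_trivial_imp[OF this]
  show ?thesis
  proof (rule Mod_normal_closure_cyclic_if_collapses[OF _ _ h(1)])
    have "h (rot n) = (int n - 1) mod int (n - 1)"
      using length_hom_rot[OF h, of n] three_le by simp
    then show "h (rot n) = 0" using three_le by (simp add: of_nat_diff)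
    show "?N #> s i = ?N #> s 1" if "1 \<le> i" "i < n" for i
      using Q(1)[OF that] by (simp only: comp_def)
    show "h (s i) = 1 mod int (n - 1)" if "1 \<le> i" "i < n" for i
      using h(2)[OF that] .
    show "(?N #> s 1) [^]\<^bsub>G Mod ?N\<^esub> (n - 1) = ?N"
      using Q(2) by (simp only: comp_def one_FactGroup)
  qed (use three_le in simp_all)
qed

theorem Mod_rot1_pred:
  assumes "has_length_hom (n - 1)" "4 \<le> n"
  shows "G Mod normal_closure G (rot1 (n - 1)) \<cong> integer_mod_group (n - 1)"
proof -
  let ?N = "normal_closure G (rot1 (n - 1))"
  obtain h where h: "h \<in> hom G (integer_mod_group (n - 1))"
    "\<And>i. \<lbrakk>1 \<le> i; i < n\<rbrakk> \<Longrightarrow> h (s i) = 1 mod int (n - 1)"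
    using assms unfolding has_length_hom_def by blast
  have x: "rot1 (n - 1) \<in> carrier G" using assms(2) by simp
  have N: "?N \<lhd> G" by (rule normal_closure_normal[OF x])
  interpret Q: sphere_mcg_system "G Mod ?N" n "(\<lambda>y. ?N #> y) \<circ> s"
    by (rule quotient_system[OF N])
  have "Q.rot1 (n - 1) = \<one>\<^bsub>G Mod ?N\<^esub>"
    unfolding one_FactGroup 
    by (subst quotient_rot1[OF N]) (use assms(2) coset_normal_closure[OF x] in simp_all)
  note Q = Q.rot1_pred_trivial_imp[OF this assms(2)]
  show ?thesis
  proof (rule Mod_normal_closure_cyclic_if_collapses[OF x _ h(1)])
    show "h (rot1 (n - 1)) = 0"
      using length_hom_rot1[OF h, of "n - 1"] assms(2) by simp
    show "?N #> s i = ?N #> s 1" if "1 \<le> i" "i < n" for i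
      using Q(1)[OF that] by (simp only: comp_def)
    show "h (s i) = 1 mod int (n - 1)" if "1 \<le> i" "i < n" for i
      using h(2)[OF that] .
    show "(?N #> s 1) [^]\<^bsub>G Mod ?N\<^esub> (n - 1) = ?N"
      using Q(2) by (simp only: comp_def one_FactGroup)
  qed (use three_le in simp_all)
qed

context
  fixes N
  defines "N \<equiv> normal_closure G (rot1 n)"
begin

lemma rot1_in_carrier: "rot1 n \<in> carrier G"
  using three_le by simp

lemma N_normal: "N \<lhd> G"
  unfolding N_def by (rule normal_closure_normal[OF rot1_in_carrier])

lemma quotient_rot1_trivial:
  "braid_system.rot (G Mod N) ((\<lambda>y. N #> y) \<circ> s) n \<otimes>\<^bsub>G Mod N\<^esub> ((\<lambda>y. N #> y) \<circ> s) (n - 1)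
    = \<one>\<^bsub>G Mod N\<^esub>"
  unfolding one_FactGroup
  by (subst quotient_rot1[OF N_normal])
    (use three_le coset_normal_closure[OF rot1_in_carrier] in \<open>simp_all add: N_def\<close>)

theorem Mod_rot1:
  assumes "has_length_hom 2" "even n"
  shows "G Mod N \<cong> integer_mod_group 2"
proof -
  obtain h where h: "h \<in> hom G (integer_mod_group 2)"
    "\<And>i. \<lbrakk>1 \<le> i; i < n\<rbrakk> \<Longrightarrow> h (s i) = 1 mod int 2"
    using assms unfolding has_length_hom_def by blast
  interpret Q: sphere_mcg_system "G Mod N" n "(\<lambda>y. N #> y) \<circ> s"
    by (rule quotient_system[OF N_normal])
  note Q = Q.rot1_trivial_imp[OF quotient_rot1_trivial]
  show ?thesis
  proof (rule Mod_normal_closure_cyclic_if_collapses[OF rot1_in_carrier _ h(1), folded N_def])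
    have "h (rot1 n) = int n mod int 2"
      using length_hom_rot1[OF h, of n] three_le by simp
    then show "h (rot1 n) = 0" using assms(2) by auto
    show "N #> s i = N #> s 1" if "1 \<le> i" "i < n" for i
      using Q(1)[OF that] by (simp only: comp_def)
    show "h (s i) = 1 mod int 2" if "1 \<le> i" "i < n" for i
      using h(2)[OF that] .
    show "(N #> s 1) [^]\<^bsub>G Mod N\<^esub> (2::nat) = N"
      using Q(2) by (simp only: comp_def one_FactGroup)
  qed simp
qed

theorem normal_closure_rot1:
  assumes "odd n"
  shows "N = carrier G"
proof -
  interpret Q: sphere_mcg_system "G Mod N" n "(\<lambda>y. N #> y) \<circ> s"
    by (rule quotient_system[OF N_normal])
  note Q = Q.rot1_trivial_imp[OF quotient_rot1_trivial]
  have sub: "subgroup N G" using N_normal by (rule normal_imp_subgroup)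
  have "s i \<in> N" if "1 \<le> i" "i < n" for i
  proof -
    have "N #> s i = N" using Q(1)[OF that] Q(3)[OF assms] by (simp only: comp_def one_FactGroup)
    then show ?thesis using rcos_self[OF gen_closed[OF that] sub] by simp
  qed
  then have "s ` {1..<n} \<subseteq> N" by auto
  then have "carrier G \<subseteq> N"
    using generate_subgroup_incl[OF _ sub] generated by simp
  then show ?thesis using subgroup.subset[OF sub] by blast
qed

text \<open>The order of \<open>rot1 n\<close> divides \<open>n - 1\<close> as its power is the full twist. It is not smaller, because
  \<open>rot1 n\<close> has length \<open>n\<close>, which is \<open>1\<close> modulo \<open>n - 1\<close>.\<close>

theorem strongly_torsion_generated_odd:
  assumes "has_length_hom (n - 1)" "odd n"
  shows "strongly_torsion_generated G (n - 1)"
proof -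
  obtain h where h: "h \<in> hom G (integer_mod_group (n - 1))"
    "\<And>i. \<lbrakk>1 \<le> i; i < n\<rbrakk> \<Longrightarrow> h (s i) = 1 mod int (n - 1)"
    using assms unfolding has_length_hom_def by blast
  interpret h: group_hom G "integer_mod_group (n - 1)" h
    using h(1) by (simp add: group_hom_def group_hom_axioms_def)
  have "rot1 n [^] (n - 1) = \<one>"
    using rot1_pow_full_twist full_twist_trivial three_le by simp
  then have "ord (rot1 n) dvd n - 1"
    using pow_eq_id[OF rot1_in_carrier] by blast
  moreover have "n - 1 dvd ord (rot1 n)"
  proof -
    have "h (rot1 n) = int n mod int (n - 1)"
      using length_hom_rot1[OF h, of n] three_le by simp
    also have "int n = 1 + int (n - 1)" using three_le by simp
    finally have "h (rot1 n) = 1 mod int (n - 1)" by (simp only: mod_add_self2)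
    moreover have "h (rot1 n [^] ord (rot1 n)) = 0"
      using pow_ord_eq_1[OF rot1_in_carrier] h.hom_one by simp
    ultimately have "int (ord (rot1 n)) mod int (n - 1) = 0"
      using h.hom_nat_pow[OF rot1_in_carrier, of "ord (rot1 n)"] by (simp add: mod_mult_right_eq)
    then show ?thesis by (metis dvd_eq_mod_eq_0 of_nat_dvd_iff)
  qed
  ultimately have "ord (rot1 n) = n - 1" by (rule dvd_antisym)
  then show ?thesis
    unfolding strongly_torsion_generated_def
    using three_le normal_closure_rot1[OF assms(2)] rot1_in_carrier
    by (intro conjI bexI[of _ "rot1 n"]) (auto simp: N_def)
qed

end

end

section \<open>Homomorphisms out of a presented group\<close>

text \<open>A name for \<open>lists (S \<times> UNIV)\<close> keeps the simplifier from rewriting membership of a word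
  into a statement about its letters.\<close>

definition words :: "'a set \<Rightarrow> 'a word set" where
  "words S = lists (S \<times> UNIV)"

lemma words_Nil [simp]: "[] \<in> words S"
  and words_Cons [simp]: "(a, b) # w \<in> words S \<longleftrightarrow> a \<in> S \<and> w \<in> words S"
  and words_append [simp]: "u @ v \<in> words S \<longleftrightarrow> u \<in> words S \<and> v \<in> words S"
  by (auto simp: words_def)

lemma words_induct [consumes 1, case_names Nil Cons]:
  assumes "w \<in> words S" "P []"
    "\<And>a b w. \<lbrakk>a \<in> S; w \<in> words S; P w\<rbrakk> \<Longrightarrow> P ((a, b) # w)"
  shows "P w"
  using assms(1)
proof (induction w)
  case (Cons l w)
  then show ?case using assms(3) by (cases l) auto
qed (use assms in simp)

lemmas pres_eq_refl = pres_eq.refl[folded words_def]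
lemmas pres_eq_cong = pres_eq.cong[folded words_def]
lemmas pres_eq_rel = pres_eq.rel[folded words_def]
lemmas pres_eq_induct = 
  pres_eq.induct[folded words_def, consumes 1, case_names refl sym trans cong cancel rel]

lemma pres_eq_in_words:
  "pres_eq S R u v \<Longrightarrow> u \<in> words S \<and> v \<in> words S"
  by (induction rule: pres_eq_induct) auto

lemma pres_class_eq:
  assumes "u \<in> words S"
  shows "pres_class S R u = pres_class S R v \<longleftrightarrow> pres_eq S R u v"
proof
  assume "pres_class S R u = pres_class S R v"
  moreover have "u \<in> pres_class S R u"
    using assms by (simp add: pres_class_def pres_eq_refl)
  ultimately have "pres_eq S R v u" by (simp add: pres_class_def)
  then show "pres_eq S R u v" by (rule pres_eq.sym)
next
  assume "pres_eq S R u v"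
  then show "pres_class S R u = pres_class S R v"
    unfolding pres_class_def by (blast intro: pres_eq.sym pres_eq.trans)
qed

lemma pres_eq_append:
  assumes "pres_eq S R u u'" "pres_eq S R v v'"
  shows "pres_eq S R (u @ v) (u' @ v')"
proof -
  have "pres_eq S R (u @ v) (u' @ v)"
    using pres_eq_cong[OF assms(1), of "[]" v] pres_eq_in_words[OF assms(2)] by simp
  moreover have "pres_eq S R (u' @ v) (u' @ v')"
    using pres_eq_cong[OF assms(2), of u' "[]"] pres_eq_in_words[OF assms(1)] by simp
  ultimately show ?thesis by (rule pres_eq.trans)
qed

lemma pres_class_mult:
  assumes "u \<in> words S" "v \<in> words S"
  shows "pres_class S R u \<otimes>\<^bsub>presented_group S R\<^esub> pres_class S R v = pres_class S R (u @ v)"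
proof -
  have eq: "pres_class S R (u' @ v') = pres_class S R (u @ v)"
    if "u' \<in> pres_class S R u" "v' \<in> pres_class S R v" for u' v'
  proof -
    have "pres_eq S R (u @ v) (u' @ v')"
      using that by (intro pres_eq_append) (auto simp: pres_class_def)
    then show ?thesis using assms by (subst eq_commute) (simp add: pres_class_eq)
  qed
  have mem: "u \<in> pres_class S R u" "v \<in> pres_class S R v"
    using assms by (auto simp: pres_class_def pres_eq_refl)
  have "pres_class S R u \<otimes>\<^bsub>presented_group S R\<^esub> pres_class S R v =
      (\<Union>u'\<in>pres_class S R u. \<Union>v'\<in>pres_class S R v. pres_class S R (u' @ v'))"
    by (simp add: presented_group_def)
  also have "\<dots> = (\<Union>u'\<in>pres_class S R u. \<Union>v'\<in>pres_class S R v. pres_class S R (u @ v))"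
    by (rule SUP_cong[OF HOL.refl], rule SUP_cong[OF HOL.refl]) (rule eq)
  also have "\<dots> = pres_class S R (u @ v)"
    using mem by blast
  finally show ?thesis .
qed

definition inverse_word :: "'a word \<Rightarrow> 'a word" where
  "inverse_word w = rev (map (\<lambda>(a, b). (a, \<not> b)) w)"

lemma inverse_word_in_words: "w \<in> words S \<Longrightarrow> inverse_word w \<in> words S"
  by (induction w rule: words_induct) (auto simp: inverse_word_def)

lemma pres_eq_inverse_word:
  "w \<in> words S \<Longrightarrow> pres_eq S R (inverse_word w @ w) []"
proof (induction w rule: words_induct)
  case (Cons a b w)
  have "pres_eq S R [(a, \<not> b), (a, b)] []"
    using pres_eq.cancel[of a S R "\<not> b"] Cons by simp
  then have "pres_eq S R (inverse_word w @ [(a, \<not> b), (a, b)] @ w) (inverse_word w @ [] @ w)"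
    using inverse_word_in_words[of w S] Cons by (intro pres_eq_cong) simp_all
  then show ?case
    using Cons by (auto simp: inverse_word_def intro: pres_eq.trans)
qed (simp add: inverse_word_def pres_eq_refl)

lemma carrier_presented_group:
  "carrier (presented_group S R) = pres_class S R ` words S"
  by (simp add: presented_group_def words_def)

lemma one_presented_group: "\<one>\<^bsub>presented_group S R\<^esub> = pres_class S R []"
  by (simp add: presented_group_def)

lemma pres_class_in_carrier [simp]:
  "w \<in> words S \<Longrightarrow> pres_class S R w \<in> carrier (presented_group S R)"
  by (simp add: carrier_presented_group)

lemma group_presented_group: "group (presented_group S R)"
proof (rule groupI)
  fix x assume "x \<in> carrier (presented_group S R)"
  then obtain w where w: "w \<in> words S" "x = pres_class S R w"
    by (auto simp: carrier_presented_group)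
  have "pres_class S R (inverse_word w) \<otimes>\<^bsub>presented_group S R\<^esub> x = \<one>\<^bsub>presented_group S R\<^esub>"
    using w(1) pres_eq_inverse_word[OF w(1), of R] inverse_word_in_words[OF w(1)]
    by (simp add: w(2) pres_class_mult one_presented_group pres_class_eq)
  then show "\<exists>y\<in>carrier (presented_group S R). y \<otimes>\<^bsub>presented_group S R\<^esub> x = \<one>\<^bsub>presented_group S R\<^esub>"
    by (rule bexI) (simp add: inverse_word_in_words[OF w(1)])
next
  fix x y z assume "x \<in> carrier (presented_group S R)" "y \<in> carrier (presented_group S R)"
    "z \<in> carrier (presented_group S R)"
  then obtain u v w where "x = pres_class S R u" "u \<in> words S" "y = pres_class S R v" "v \<in> words S"
    "z = pres_class S R w" "w \<in> words S"
    unfolding carrier_presented_group by blast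
  then show "x \<otimes>\<^bsub>presented_group S R\<^esub> y \<otimes>\<^bsub>presented_group S R\<^esub> z = 
      x \<otimes>\<^bsub>presented_group S R\<^esub> (y \<otimes>\<^bsub>presented_group S R\<^esub> z)"
    by (simp add: pres_class_mult)
next
  fix x y assume "x \<in> carrier (presented_group S R)" "y \<in> carrier (presented_group S R)"
  then obtain u v where "x = pres_class S R u" "u \<in> words S" "y = pres_class S R v" "v \<in> words S"
    unfolding carrier_presented_group by blast
  then show "x \<otimes>\<^bsub>presented_group S R\<^esub> y \<in> carrier (presented_group S R)"
    by (simp add: pres_class_mult)
next
  fix x assume "x \<in> carrier (presented_group S R)"
  then obtain u where "x = pres_class S R u" "u \<in> words S"
    unfolding carrier_presented_group by blast
  then show "\<one>\<^bsub>presented_group S R\<^esub> \<otimes>\<^bsub>presented_group S R\<^esub> x = x"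
    by (simp add: pres_class_mult one_presented_group)
qed (simp add: one_presented_group)

lemma inv_pres_class:
  assumes "w \<in> words S"
  shows "inv\<^bsub>presented_group S R\<^esub> (pres_class S R w) = pres_class S R (inverse_word w)"
proof (rule group.inv_equality[OF group_presented_group])
  show "pres_class S R (inverse_word w) \<otimes>\<^bsub>presented_group S R\<^esub> pres_class S R w = \<one>\<^bsub>presented_group S R\<^esub>"
    using assms pres_eq_inverse_word[of w S R] inverse_word_in_words[OF assms]
    by (simp add: pres_class_mult one_presented_group pres_class_eq)
qed (use assms inverse_word_in_words[OF assms] in simp_all)

lemma presented_group_generated:
  "carrier (presented_group S R) = 
     generate (presented_group S R) ((\<lambda>a. pres_class S R [(a, True)]) ` S)"
    (is "carrier ?G = generate ?G ?s")
proof
  interpret group ?G by (rule group_presented_group)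
  have sub: "?s \<subseteq> carrier ?G" by auto
  then show "generate ?G ?s \<subseteq> carrier ?G" by (rule generate_incl)
  have letter: "pres_class S R [(a, b)] \<in> generate ?G ?s" if "a \<in> S" for a b
  proof (cases b)
    case True
    then show ?thesis using that by (auto intro: generate.incl)
  next
    case False
    then have "pres_class S R [(a, b)] = inv\<^bsub>?G\<^esub> (pres_class S R [(a, True)])"
      using that by (simp add: inv_pres_class inverse_word_def)
    then show ?thesis using that by (auto intro: generate.inv)
  qed
  have "pres_class S R w \<in> generate ?G ?s" if "w \<in> words S" for w
    using that
  proof (induction w rule: words_induct)
    case Nil
    then show ?case using generate.one[of ?G ?s] by (simp add: one_presented_group)
  next
    case (Cons a b w)
    have "pres_class S R ((a, b) # w) = pres_class S R [(a, b)] \<otimes>\<^bsub>?G\<^esub> pres_class S R w"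
      using Cons.hyps by (simp add: pres_class_mult)
    then show ?case
      using generate.eng[OF letter[of a b] Cons.IH] Cons.hyps by simp
  qed
  then show "carrier ?G \<subseteq> generate ?G ?s" 
    unfolding carrier_presented_group by (rule image_subsetI)
qed

definition eval_word :: "('g, 'm) monoid_scheme \<Rightarrow> ('a \<Rightarrow> 'g) \<Rightarrow> 'a word \<Rightarrow> 'g" where
  "eval_word H f w = 
     foldr (\<lambda>(a, b) x. (if b then f a else inv\<^bsub>H\<^esub> (f a)) \<otimes>\<^bsub>H\<^esub> x) w \<one>\<^bsub>H\<^esub>"

lemma eval_word_Nil [simp]: "eval_word H f [] = \<one>\<^bsub>H\<^esub>"
  and eval_word_Cons [simp]: 
    "eval_word H f ((a, b) # w) = (if b then f a else inv\<^bsub>H\<^esub> (f a)) \<otimes>\<^bsub>H\<^esub> eval_word H f w"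
  by (simp_all add: eval_word_def)

lemma (in group) eval_word_closed:
  assumes "w \<in> words S" "f \<in> S \<rightarrow> carrier G"
  shows "eval_word G f w \<in> carrier G"
  using assms(1)
proof (induction w rule: words_induct)
  case (Cons a b w)
  then have "f a \<in> carrier G" using assms(2) by (meson PiE)
  with Cons show ?case by simp
qed simp

lemma (in group) eval_word_append:
  assumes "f \<in> S \<rightarrow> carrier G" "u \<in> words S" "v \<in> words S"
  shows "eval_word G f (u @ v) = eval_word G f u \<otimes> eval_word G f v"
  using assms(2)
proof (induction u rule: words_induct)
  case (Cons a b u)
  have "f a \<in> carrier G" using assms(1) Cons by (meson PiE)
  with Cons show ?case using eval_word_closed[OF _ assms(1)] assms(3) by (simp add: m_assoc)
qed (use eval_word_closed[OF assms(3,1)] in simp)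

text \<open>The evaluation map respects every rule that generates \<open>pres_eq\<close>, so it is constant on classes and may
  be computed on an arbitrary representative.\<close>

theorem (in group) von_Dyck:
  assumes f: "f \<in> S \<rightarrow> carrier G"
    and rels: "\<And>u v. (u, v) \<in> R \<Longrightarrow> eval_word G f u = eval_word G f v"
  obtains h where "h \<in> hom (presented_group S R) G"
    "\<And>w. w \<in> words S \<Longrightarrow> h (pres_class S R w) = eval_word G f w"
proof -
  have respects: "pres_eq S R u v \<Longrightarrow> eval_word G f u = eval_word G f v" for u v
  proof (induction rule: pres_eq_induct)
    case (cong u v x y)
    then show ?case
      using pres_eq_in_words[OF cong(1)] by (simp add: eval_word_append[OF f])
  next
    case (cancel a b)
    then have "f a \<in> carrier G" using f by (meson PiE)
    then show ?case by simp
  next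
    case (rel u v)
    then show ?case using rels by blast
  qed simp_all
  define h where "h A = eval_word G f (SOME w. w \<in> A)" for A
  have h: "h (pres_class S R w) = eval_word G f w" if "w \<in> words S" for w
  proof -
    have "w \<in> pres_class S R w" using that by (simp add: pres_class_def pres_eq_refl)
    then have "(SOME v. v \<in> pres_class S R w) \<in> {v. pres_eq S R w v}"
      unfolding pres_class_def[symmetric] by (rule someI)
    then show ?thesis unfolding h_def using respects by simp
  qed
  have "h \<in> hom (presented_group S R) G"
  proof (rule homI)
    fix x y assume "x \<in> carrier (presented_group S R)" "y \<in> carrier (presented_group S R)"
    then obtain u v where "u \<in> words S" "x = pres_class S R u"
      "v \<in> words S" "y = pres_class S R v"
      by (auto simp: carrier_presented_group)
    then show "h (x \<otimes>\<^bsub>presented_group S R\<^esub> y) = h x \<otimes> h y"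
      by (simp add: pres_class_mult h eval_word_append[OF f])
  next
    fix x assume "x \<in> carrier (presented_group S R)"
    then show "h x \<in> carrier G"
      using h eval_word_closed[OF _ f] by (auto simp: carrier_presented_group)
  qed
  with h that show thesis by blast
qed

section \<open>Crossing numbers of pairs of strands\<close>

text \<open>The strands are numbered by their initial positions. \<open>strand_pos w p\<close> is the final position of strand \<open>p\<close>,
  and \<open>crossings w p q\<close> counts the crossings of the strands \<open>p\<close> and \<open>q\<close> with sign; after the first letter the
  strands are renamed by their new positions, which leads to the recursion on the left end of the word.\<close>

abbreviation swap :: "nat \<Rightarrow> nat \<Rightarrow> nat" where
  "swap i \<equiv> Transposition.transpose i (Suc i)"

fun strand_pos :: "nat word \<Rightarrow> nat \<Rightarrow> nat" where
  "strand_pos [] p = p"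
| "strand_pos ((i, b) # w) p = strand_pos w (swap i p)"

fun crossings :: "nat word \<Rightarrow> nat \<Rightarrow> nat \<Rightarrow> int" where
  "crossings [] p q = 0"
| "crossings ((i, b) # w) p q =
     (if {p, q} = {i, Suc i} then if b then 1 else - 1 else 0) + crossings w (swap i p) (swap i q)"

definition exponent_sum :: "'a word \<Rightarrow> int" where
  "exponent_sum w = (\<Sum>(a, b)\<leftarrow>w. if b then 1 else - 1)"

lemma exponent_sum_simps [simp]:
  "exponent_sum [] = 0"
  "exponent_sum ((a, b) # w) = (if b then 1 else - 1) + exponent_sum w"
  "exponent_sum (u @ v) = exponent_sum u + exponent_sum v"
  by (simp_all add: exponent_sum_def)

lemma strand_pos_append: "strand_pos (u @ v) p = strand_pos v (strand_pos u p)"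
  by (induction u p rule: strand_pos.induct) auto

lemma crossings_append:
  "crossings (u @ v) p q = crossings u p q + crossings v (strand_pos u p) (strand_pos u q)"
  by (induction u p q rule: crossings.induct) auto

lemma crossings_self [simp]: "crossings w p p = 0"
  by (induction w p p rule: crossings.induct) (auto simp: doubleton_eq_iff)

lemma swap_permutes: "1 \<le> i \<Longrightarrow> i < n \<Longrightarrow> swap i permutes {1..n}"
  by (rule permutes_swap_id) auto

lemma strand_pos_permutes:
  "w \<in> words {1..<n} \<Longrightarrow> strand_pos w permutes {1..n}"
proof (induction w rule: words_induct)
  case (Cons i b w)
  have "strand_pos ((i, b) # w) = strand_pos w \<circ> swap i" by auto
  moreover have "swap i permutes {1..n}" using Cons.hyps by (intro swap_permutes) auto
  ultimately show ?case using permutes_compose Cons.IH by metis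
next
  case Nil
  have "strand_pos [] = id" by auto
  then show ?case by (simp only: permutes_id)
qed

lemma swap_doubleton:
  "{swap i p, swap i q} = {x, y} \<longleftrightarrow> {p, q} = {swap i x, swap i y}"
proof -
  have "{p, q} = {swap i x, swap i y} \<longleftrightarrow> swap i ` {p, q} = swap i ` {swap i x, swap i y}"
    by (rule inj_image_eq_iff[symmetric]) simp
  then show ?thesis by simp
qed

lemma sum_doubleton_indicator:
  assumes "1 \<le> i" "i < n"
  shows "(\<Sum>q\<in>{1..n}. if {p, q} = {i, Suc i} then c else (0::int)) = 
    (if p = i \<or> p = Suc i then c else 0)"
proof -
  have "{p, q} = {i, Suc i} \<longleftrightarrow> (p = i \<and> q = Suc i) \<or> (p = Suc i \<and> q = i)" for q
    by (auto simp: doubleton_eq_iff)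
  then have "(\<Sum>q\<in>{1..n}. if {p, q} = {i, Suc i} then c else (0::int)) =
      (\<Sum>q\<in>{1..n}. if q = (if p = i then Suc i else i) 
         then if p = i \<or> p = Suc i then c else 0 else 0)"
    by (intro sum.cong) auto
  also have "\<dots> = (if p = i \<or> p = Suc i then c else 0)"
    using assms by (subst sum.delta) auto
  finally show ?thesis .
qed

lemma sum_permute_index:
  fixes f :: "nat \<Rightarrow> int"
  shows "g permutes A \<Longrightarrow> (\<Sum>q\<in>A. f (g q)) = sum f A"
  using sum.permute[of g A f] by (simp add: o_def)

text \<open>Each crossing of strand \<open>p\<close> moves it by one position.\<close>

lemma crossings_row_parity:
  assumes "w \<in> words {1..<n}"
  shows "even ((\<Sum>q\<in>{1..n}. crossings w p q) + int (strand_pos w p) - int p)"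
  using assms
proof (induction w arbitrary: p rule: words_induct)
  case (Cons i b w)
  let ?c = "if b then 1 else - 1 :: int"
  have "(\<Sum>q\<in>{1..n}. crossings ((i, b) # w) p q) =
      (if p = i \<or> p = Suc i then ?c else 0) + (\<Sum>q\<in>{1..n}. crossings w (swap i p) q)"
    using Cons.hyps sum_doubleton_indicator[of i n p ?c]
      sum_permute_index[OF swap_permutes[of i n], of "crossings w (swap i p)"]
    by (simp add: sum.distrib)
  moreover have "even ((if p = i \<or> p = Suc i then ?c else 0) + int (swap i p) - int p)"
    by (auto simp: Transposition.transpose_def)
  moreover note Cons.IH[of "swap i p"]
  ultimately show ?case by (simp add: algebra_simps)
qed simp

text \<open>Each crossing of \<open>p\<close> and \<open>q\<close> reverses their order, and no other crossing does.\<close>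

lemma crossings_pair_parity:
  assumes "p \<noteq> q"
  shows "even (crossings w p q) \<longleftrightarrow> (p < q \<longleftrightarrow> strand_pos w p < strand_pos w q)"
  using assms
proof (induction w p q rule: crossings.induct)
  case (2 i b w p q)
  have ne: "swap i p \<noteq> swap i q" using 2(2) by (simp add: inj_eq)
  show ?case
  proof (cases "{p, q} = {i, Suc i}")
    case True
    then show ?thesis
      using 2(1)[OF ne] by (auto simp: doubleton_eq_iff)
  next
    case False
    then have "p < q \<longleftrightarrow> swap i p < swap i q"
      using 2(2) by (auto simp: Transposition.transpose_def doubleton_eq_iff)
    then show ?thesis using 2(1)[OF ne] False by simp
  qed
qed simp

text \<open>Every letter is a crossing of one pair of strands, which the double sum counts twice.\<close>

lemma sum_crossings:
  assumes "w \<in> words {1..<n}"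
  shows "(\<Sum>p\<in>{1..n}. \<Sum>q\<in>{1..n}. crossings w p q) = 2 * exponent_sum w"
  using assms
proof (induction w rule: words_induct)
  case (Cons i b w)
  let ?c = "if b then 1 else - 1 :: int"
  have perm: "swap i permutes {1..n}" using Cons.hyps by (intro swap_permutes) auto
  have "(\<Sum>p\<in>{1..n}. if p = i \<or> p = Suc i then ?c else 0) = (\<Sum>p\<in>{i, Suc i}. ?c)"
    using Cons.hyps by (intro sum.mono_neutral_cong_right) auto
  then have "(\<Sum>p\<in>{1..n}. \<Sum>q\<in>{1..n}. if {p, q} = {i, Suc i} then ?c else 0) = 2 * ?c"
    using Cons.hyps sum_doubleton_indicator[of i n _ ?c] by simp
  moreover have "(\<Sum>p\<in>{1..n}. \<Sum>q\<in>{1..n}. crossings w (swap i p) (swap i q)) = 2 * exponent_sum w"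
    using sum_permute_index[OF perm, of "crossings w (swap i _)"]
      sum_permute_index[OF perm, of "\<lambda>p. \<Sum>q\<in>{1..n}. crossings w p q"] Cons.IH
    by (simp add: sum_permute_index[OF perm])
  ultimately show ?case by (simp add: sum.distrib)
qed simp

text \<open>Crossing numbers of spherical braids are only defined up to the functions \<open>c p q = t p + t q\<close>: moving
  strand \<open>p\<close> once around all others adds \<open>2\<close> to every \<open>c p q\<close>, so this is the case where \<open>t\<close> is \<open>2\<close> at \<open>p\<close>
  and \<open>0\<close> elsewhere. Constant \<open>t\<close> accounts for full twists.\<close>

definition vertex_sum :: "nat \<Rightarrow> (nat \<Rightarrow> nat \<Rightarrow> int) \<Rightarrow> bool" where
  "vertex_sum n c \<longleftrightarrow> (\<exists>t. \<forall>p\<in>{1..n}. \<forall>q\<in>{1..n}. p \<noteq> q \<longrightarrow> c p q = t p + t q)"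

lemma vertex_sum_zero: "vertex_sum n (\<lambda>p q. 0)"
  unfolding vertex_sum_def by (intro exI[of _ "\<lambda>_. 0"]) simp

lemma vertex_sum_add:
  assumes "vertex_sum n c" "vertex_sum n d"
  shows "vertex_sum n (\<lambda>p q. c p q + d p q)"
proof -
  from assms obtain t u where
    "\<forall>p\<in>{1..n}. \<forall>q\<in>{1..n}. p \<noteq> q \<longrightarrow> c p q = t p + t q"
    "\<forall>p\<in>{1..n}. \<forall>q\<in>{1..n}. p \<noteq> q \<longrightarrow> d p q = u p + u q"
    unfolding vertex_sum_def by blast
  then show ?thesis
    unfolding vertex_sum_def by (intro exI[of _ "\<lambda>p. t p + u p"]) simp
qed

lemma vertex_sum_uminus:
  assumes "vertex_sum n c"
  shows "vertex_sum n (\<lambda>p q. - c p q)"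
proof -
  from assms obtain t where
    "\<forall>p\<in>{1..n}. \<forall>q\<in>{1..n}. p \<noteq> q \<longrightarrow> c p q = t p + t q"
    unfolding vertex_sum_def by blast
  then show ?thesis
    unfolding vertex_sum_def by (intro exI[of _ "\<lambda>p. - t p"]) simp
qed

lemma vertex_sum_permute:
  assumes "vertex_sum n c" "g permutes {1..n}"
  shows "vertex_sum n (\<lambda>p q. c (g p) (g q))"
proof -
  from assms(1) obtain t where
    t: "\<forall>p\<in>{1..n}. \<forall>q\<in>{1..n}. p \<noteq> q \<longrightarrow> c p q = t p + t q"
    unfolding vertex_sum_def by blast
  have "c (g p) (g q) = t (g p) + t (g q)" if "p \<in> {1..n}" "q \<in> {1..n}" "p \<noteq> q" for p q
    using t that permutes_in_image[OF assms(2)] inj_eq[OF permutes_inj[OF assms(2)]] by blast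
  then show ?thesis
    unfolding vertex_sum_def by (intro exI[of _ "\<lambda>p. t (g p)"]) simp
qed

lemma vertex_sum_cong:
  assumes "vertex_sum n c" "\<And>p q. \<lbrakk>p \<in> {1..n}; q \<in> {1..n}; p \<noteq> q\<rbrakk> \<Longrightarrow> c p q = d p q"
  shows "vertex_sum n d"
proof -
  from assms(1) obtain t where
    t: "\<forall>p\<in>{1..n}. \<forall>q\<in>{1..n}. p \<noteq> q \<longrightarrow> c p q = t p + t q"
    unfolding vertex_sum_def by blast
  then show ?thesis
    unfolding vertex_sum_def using assms(2) by (intro exI[of _ t]) simp
qed

lemma sigma_word_in_words [simp]: "sigma_word is \<in> words S \<longleftrightarrow> set is \<subseteq> S"
  by (induction "is") (auto simp: sigma_word_def)

lemma sigma_word_append: "sigma_word (is @ js) = sigma_word is @ sigma_word js"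
  by (simp add: sigma_word_def)

lemma sigma_word_simps [simp]:
  "sigma_word [] = []" "sigma_word (i # is) = (i, True) # sigma_word is"
  by (simp_all add: sigma_word_def)

text \<open>Strand \<open>1\<close> crosses the next \<open>k - 1\<close> strands on its way to position \<open>k\<close>; each of them moves down by one.\<close>

lemma strand_pos_rot:
  assumes "1 \<le> k"
  shows "strand_pos (sigma_word [1..<k]) p = 
    (if p = 1 then k else if 2 \<le> p \<and> p \<le> k then p - 1 else p)"
  using assms
proof (induction k rule: nat_induct_at_least)
  case (Suc k)
  then show ?case
    by (auto simp: sigma_word_append strand_pos_append Transposition.transpose_def)
qed simp

lemma strand_pos_rot_doubleton:
  assumes "1 \<le> k"
  shows "{strand_pos (sigma_word [1..<k]) p, strand_pos (sigma_word [1..<k]) q} = {k, Suc k} \<longleftrightarrow>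
    {p, q} = {1, Suc k}"
  unfolding strand_pos_rot[OF assms] using assms by (auto simp: doubleton_eq_iff)

lemma crossings_rot:
  assumes "1 \<le> k"
  shows "crossings (sigma_word [1..<k]) p q = 
    (if p = 1 \<and> 2 \<le> q \<and> q \<le> k \<or> q = 1 \<and> 2 \<le> p \<and> p \<le> k then 1 else 0)"
  using assms
proof (induction k rule: nat_induct_at_least)
  case (Suc k)
  let ?f = "strand_pos (sigma_word [1..<k])"
  have "{?f p, ?f q} = {k, Suc k} \<longleftrightarrow> {p, q} = {1, Suc k}"
    by (rule strand_pos_rot_doubleton[OF Suc.hyps])
  then show ?case
    using Suc by (auto simp: sigma_word_append crossings_append doubleton_eq_iff)
qed simp

text \<open>Induction on \<open>k\<close>: the word for \<open>Suc k\<close> has two further letters in the middle, which make strand \<open>1\<close>, at that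
  time at position \<open>k\<close>, go once around strand \<open>Suc k\<close>.\<close>

lemma sphere_relator:
  assumes "1 \<le> k"
  shows "strand_pos (sigma_word ([1..<k] @ rev [1..<k])) p = p"
    and "crossings (sigma_word ([1..<k] @ rev [1..<k])) p q =
      (if p = 1 \<and> 2 \<le> q \<and> q \<le> k \<or> q = 1 \<and> 2 \<le> p \<and> p \<le> k then 2 else 0)"
  using assms
proof (induction k rule: nat_induct_at_least)
  case (Suc k)
  let ?u = "sigma_word [1..<k]" and ?v = "sigma_word (rev [1..<k])"
  let ?f = "strand_pos ?u"
  have split: "sigma_word ([1..<Suc k] @ rev [1..<Suc k]) = ?u @ [(k, True), (k, True)] @ ?v"
    using Suc.hyps by (simp add: sigma_word_append)
  { case 1
    show ?case
      using Suc.IH(1) unfolding split by (simp add: sigma_word_append strand_pos_append)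
  next
    case 2
    have "{?f p, ?f q} = {k, Suc k} \<longleftrightarrow> {p, q} = {1, Suc k}"
      by (rule strand_pos_rot_doubleton[OF Suc.hyps])
    moreover have "{swap k (?f p), swap k (?f q)} = {k, Suc k} \<longleftrightarrow> {?f p, ?f q} = {k, Suc k}"
      by (subst swap_doubleton) (simp add: insert_commute)
    ultimately have "crossings (sigma_word ([1..<Suc k] @ rev [1..<Suc k])) p q =
      (if {p, q} = {1, Suc k} then 2 else 0) + crossings (sigma_word ([1..<k] @ rev [1..<k])) p q"
      unfolding split by (simp add: sigma_word_append crossings_append strand_pos_append)
    then show ?case
      using Suc.hyps unfolding Suc.IH(2) by (auto simp: doubleton_eq_iff)
  }
qed simp_all

definition same_crossings :: "nat \<Rightarrow> nat word \<Rightarrow> nat word \<Rightarrow> bool" where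
  "same_crossings n u v \<longleftrightarrow> strand_pos u = strand_pos v \<and>
     vertex_sum n (\<lambda>p q. crossings u p q - crossings v p q)"

lemma same_crossings_if_equal:
  assumes "\<And>p. strand_pos u p = strand_pos v p" "\<And>p q. crossings u p q = crossings v p q"
  shows "same_crossings n u v"
  using assms vertex_sum_zero by (auto simp: same_crossings_def)

lemma crossings_far_relation:
  assumes "i + 2 \<le> j"
  shows "strand_pos (sigma_word [i, j]) p = strand_pos (sigma_word [j, i]) p"
    and "crossings (sigma_word [i, j]) p q = crossings (sigma_word [j, i]) p q"
proof -
  show "strand_pos (sigma_word [i, j]) p = strand_pos (sigma_word [j, i]) p"
    using assms by (auto simp: Transposition.transpose_def)
  have "swap i j = j" "swap i (Suc j) = Suc j" "swap j i = i" "swap j (Suc i) = Suc i"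
    using assms by (auto simp: Transposition.transpose_def)
  then show "crossings (sigma_word [i, j]) p q = crossings (sigma_word [j, i]) p q"
    by (simp add: swap_doubleton)
qed

lemma crossings_braid_relation:
  shows "strand_pos (sigma_word [i, Suc i, i]) p = strand_pos (sigma_word [Suc i, i, Suc i]) p"
    and "crossings (sigma_word [i, Suc i, i]) p q = crossings (sigma_word [Suc i, i, Suc i]) p q"
proof -
  show "strand_pos (sigma_word [i, Suc i, i]) p = strand_pos (sigma_word [Suc i, i, Suc i]) p"
    by (auto simp: Transposition.transpose_def)
  have "swap i (Suc (Suc i)) = Suc (Suc i)" "swap (Suc i) i = i"
    by (auto simp: Transposition.transpose_def)
  then show "crossings (sigma_word [i, Suc i, i]) p q = crossings (sigma_word [Suc i, i, Suc i]) p q"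
    by (simp add: swap_doubleton)
qed

lemma sphere_braid_rels_cases [consumes 1, case_names far braid sphere]:
  assumes "(u, v) \<in> sphere_braid_rels n"
  obtains i j where "u = sigma_word [i, j]" "v = sigma_word [j, i]" "i + 2 \<le> j \<or> j + 2 \<le> i"
      "i \<in> {1..<n}" "j \<in> {1..<n}"
    | i where "u = sigma_word [i, Suc i, i]" "v = sigma_word [Suc i, i, Suc i]" "1 \<le> i" "Suc i < n"
    | "u = sigma_word ([1..<n] @ rev [1..<n])" "v = []"
  using assms unfolding sphere_braid_rels_def by force

lemma same_crossings_if_rel:
  assumes "(u, v) \<in> sphere_braid_rels n" "1 \<le> n"
  shows "same_crossings n u v"
proof -
  from assms(1) show ?thesis
  proof (cases rule: sphere_braid_rels_cases)
    case far
    then show ?thesis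
      using crossings_far_relation by (intro same_crossings_if_equal) (metis, metis)
  next
    case braid
    then show ?thesis
      using crossings_braid_relation by (intro same_crossings_if_equal) (metis, metis)
  next
    case sphere
    have "vertex_sum n (crossings u)"
      unfolding vertex_sum_def sphere(1) sphere_relator(2)[OF assms(2)]
      by (intro exI[of _ "\<lambda>p. if p = 1 then 2 else 0"]) auto
    then show ?thesis
      using sphere_relator(1)[OF assms(2)] by (auto simp: same_crossings_def sphere)
  qed
qed

text \<open>The two braid relations preserve all crossing numbers, and the sphere relator alters them
  by a \<open>vertex_sum\<close>. Such functions are stable under permutations of the strands, so a change in the
  middle of a word has the same effect.\<close>

theorem same_crossings_if_pres_eq:
  assumes "pres_eq {1..<n} (sphere_braid_rels n) u v" "1 \<le> n"
  shows "same_crossings n u v"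
  using assms(1)
proof (induction rule: pres_eq_induct)
  case (refl w)
  then show ?case by (intro same_crossings_if_equal) simp_all
next
  case (sym u v)
  then show ?case
    using vertex_sum_uminus[of n "\<lambda>p q. crossings u p q - crossings v p q"]
    by (simp add: same_crossings_def)
next
  case (trans u v w)
  then show ?case
    using vertex_sum_add[of n "\<lambda>p q. crossings u p q - crossings v p q"
        "\<lambda>p q. crossings v p q - crossings w p q"]
    by (simp add: same_crossings_def)
next
  case (cong u v x y)
  then have eq: "strand_pos u = strand_pos v"
    and vs: "vertex_sum n (\<lambda>p q. crossings u p q - crossings v p q)"
    by (simp_all add: same_crossings_def)
  have "vertex_sum n (\<lambda>p q. crossings (x @ u @ y) p q - crossings (x @ v @ y) p q)"
    using vertex_sum_permute[OF vs strand_pos_permutes[OF cong(2)]]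
    by (simp add: crossings_append strand_pos_append eq)
  then show ?case
    using eq by (auto simp: same_crossings_def strand_pos_append)
next
  case (cancel a b)
  have "{swap a p, swap a q} = {a, Suc a} \<longleftrightarrow> {p, q} = {a, Suc a}" for p q
    by (subst swap_doubleton) (simp add: insert_commute)
  then show ?case by (intro same_crossings_if_equal) auto
next
  case (rel u v)
  then show ?case using same_crossings_if_rel assms(2) by blast
qed

section \<open>Fixed points of permutations of prime power order\<close>

text \<open>The points that are not fixed fall into orbits of length \<open>p\<close>.\<close>

lemma card_fixpoints_prime_cong:
  fixes p :: nat
  assumes p: "prime p" and fin: "finite A" and f: "f ` A \<subseteq> A"
    and per: "\<And>x. x \<in> A \<Longrightarrow> (f ^^ p) x = x"
  shows "[card {x \<in> A. f x = x} = card A] (mod p)"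
proof -
  have per_mult: "(f ^^ (p * k)) x = x" if "x \<in> A" for x k
    using per[OF that] by (induction k) (simp_all add: funpow_add)
  have closed: "(f ^^ k) x \<in> A" if "x \<in> A" for x k
    using that f by (induction k) auto
  define orb where "orb x = range (\<lambda>k. (f ^^ k) x)" for x
  have orb_eq: "orb y = orb x" if "x \<in> A" "y \<in> orb x" for x y
  proof -
    from that obtain i where y: "y = (f ^^ i) x" by (auto simp: orb_def)
    have "i \<le> p * i" using prime_gt_0_nat[OF p] by simp
    then have x: "x = (f ^^ (p * i - i)) y"
      using per_mult[OF that(1), of i] by (simp add: y flip: funpow_add[THEN fun_cong, simplified])
    have "(f ^^ k) y = (f ^^ (k + i)) x" for k
      by (simp add: y funpow_add)
    moreover have "(f ^^ k) x = (f ^^ (k + (p * i - i))) y" for k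
      by (subst x) (simp add: funpow_add)
    ultimately show ?thesis unfolding orb_def by (intro equalityI) force+
  qed
  have card_orb: "card (orb x) = p" if x: "x \<in> A" "f x \<noteq> x" for x
  proof -
    have mod: "(f ^^ k) x = (f ^^ (k mod p)) x" for k
    proof -
      have "(f ^^ k) x = (f ^^ (k mod p + p * (k div p))) x" by simp
      also have "\<dots> = (f ^^ (k mod p)) x"
        unfolding funpow_add using per_mult[OF x(1)] by simp
      finally show ?thesis .
    qed
    have "orb x = (\<lambda>k. (f ^^ k) x) ` {..<p}"
    proof (intro equalityI subsetI)
      fix y assume "y \<in> orb x"
      then obtain k where "y = (f ^^ k) x" by (auto simp: orb_def)
      then have "y = (f ^^ (k mod p)) x" using mod by simp
      then show "y \<in> (\<lambda>k. (f ^^ k) x) ` {..<p}"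
        using prime_gt_0_nat[OF p] by (intro image_eqI[of _ _ "k mod p"]) auto
    qed (auto simp: orb_def)
    moreover have "inj_on (\<lambda>k. (f ^^ k) x) {..<p}"
    proof (rule linorder_inj_onI')
      fix i j assume ij: "i \<in> {..<p}" "j \<in> {..<p}" "i < j"
      show "(f ^^ i) x \<noteq> (f ^^ j) x"
      proof
        assume "(f ^^ i) x = (f ^^ j) x"
        then have "(f ^^ (p - i)) ((f ^^ i) x) = (f ^^ (p - i)) ((f ^^ j) x)" by simp
        then have eq: "(f ^^ (p - i + i)) x = (f ^^ (p - i + j)) x" unfolding funpow_add by simp
        have shift: "p - i + i = p" "p - i + j = (j - i) + p" using ij by auto
        have "(f ^^ p) x = (f ^^ (j - i)) ((f ^^ p) x)"
          using eq unfolding shift by (simp add: funpow_add)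
        then have "(f ^^ (j - i)) x = x" using per[OF x(1)] by simp
        then have *: "(f ^^ ((j - i) * k)) x = x" for k
          by (induction k) (simp_all add: funpow_add)
        \<comment> \<open>A period \<open>j - i\<close> prime to the period \<open>p\<close> would make \<open>1\<close> a period.\<close>
        have "coprime (j - i) p"
          using ij p by (intro prime_imp_coprime_nat[THEN coprime_commute[THEN iffD1]])
            (auto dest: dvd_imp_le)
        then obtain u where "[(j - i) * u = Suc 0] (mod p)"
          using cong_solve_coprime_nat by blast
        then have "((j - i) * u) mod p = 1"
          using prime_gt_1_nat[OF p] by (simp add: cong_def)
        then have "(f ^^ ((j - i) * u)) x = f x" by (subst mod) simp
        with * x(2) show False by simp
      qed
    qed
    ultimately show ?thesis by (simp add: card_image)
  qed
  let ?B = "{x \<in> A. f x \<noteq> x}"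
  have self: "x \<in> orb x" for x unfolding orb_def by (rule range_eqI[of _ _ 0]) simp
  have moved: "f y \<noteq> y" if "x \<in> ?B" "y \<in> orb x" for x y
  proof
    assume "f y = y"
    then have "(f ^^ k) y = y" for k by (induction k) auto
    then have "orb y = {y}" by (auto simp: orb_def)
    then have "x = y" using orb_eq[of x y] that self[of x] by auto
    then show False using that \<open>f y = y\<close> by simp
  qed
  have un: "\<Union> (orb ` ?B) = ?B"
    using self moved closed by (auto simp: orb_def)
  have "p dvd card (\<Union> (orb ` ?B))"
  proof (rule dvd_partition)
    show "finite (\<Union> (orb ` ?B))" unfolding un using fin by simp
    show "\<forall>c\<in>orb ` ?B. p dvd card c" using card_orb by auto
    show "\<forall>c1\<in>orb ` ?B. \<forall>c2\<in>orb ` ?B. c1 \<noteq> c2 \<longrightarrow> c1 \<inter> c2 = {}"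
      using orb_eq by blast
  qed
  then have "p dvd card ?B" unfolding un .
  moreover have "card A = card {x \<in> A. f x = x} + card ?B"
    using fin by (subst card_Un_disjoint[symmetric]) (auto intro: arg_cong[where f = card])
  ultimately show ?thesis by (auto simp: cong_def elim!: dvdE)
qed

text \<open>Induction on \<open>b\<close>: \<open>f ^^ p\<close> has the period \<open>p ^ b\<close>, and on its fixed points \<open>f\<close> has period \<open>p\<close>.\<close>

lemma card_fixpoints_prime_power_cong:
  fixes p :: nat
  assumes p: "prime p" and fin: "finite A" and f: "f ` A \<subseteq> A"
    and per: "\<And>x. x \<in> A \<Longrightarrow> (f ^^ (p ^ b)) x = x"
  shows "[card {x \<in> A. f x = x} = card A] (mod p)"
  using f per
proof (induction b arbitrary: f)
  case 0
  then have "{x \<in> A. f x = x} = A" by auto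
  then show ?case by simp
next
  case (Suc b)
  define g where "g = f ^^ p"
  define B where "B = {x \<in> A. g x = x}"
  have closed: "(f ^^ k) ` A \<subseteq> A" for k
    using Suc.prems(1) by (induction k) auto
  have "[card B = card A] (mod p)"
    unfolding B_def
  proof (rule Suc.IH)
    show "g ` A \<subseteq> A" using closed by (simp add: g_def)
    show "(g ^^ (p ^ b)) x = x" if "x \<in> A" for x
      using Suc.prems(2)[OF that] by (simp add: g_def funpow_mult mult.commute)
  qed
  moreover have "[card {x \<in> B. f x = x} = card B] (mod p)"
  proof (rule card_fixpoints_prime_cong[OF p])
    show "finite B" using fin by (simp add: B_def)
    show "f ` B \<subseteq> B"
    proof (rule image_subsetI)
      fix x assume "x \<in> B"
      then show "f x \<in> B"
        using Suc.prems(1) funpow_swap1[of f p x] by (auto simp: B_def g_def)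
    qed
    show "(f ^^ p) x = x" if "x \<in> B" for x using that by (simp add: B_def g_def)
  qed
  moreover have "{x \<in> B. f x = x} = {x \<in> A. f x = x}"
  proof -
    have "(f ^^ k) x = x" if "f x = x" for k x using that by (induction k) auto
    then show ?thesis by (auto simp: B_def g_def)
  qed
  ultimately show ?case by (metis cong_trans)
qed

section \<open>Exponent sums of periodic braids\<close>

definition word_power :: "nat \<Rightarrow> 'a word \<Rightarrow> 'a word" where
  "word_power m w = concat (replicate m w)"

lemma word_power_simps [simp]:
  "word_power 0 w = []" "word_power (Suc m) w = w @ word_power m w"
  by (simp_all add: word_power_def)

lemma word_power_in_words: "w \<in> words S \<Longrightarrow> word_power m w \<in> words S"
  by (induction m) auto

lemma word_power_mult: "word_power k (word_power m w) = word_power (k * m) w"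
  by (induction k) (simp_all add: word_power_def replicate_add)

lemma exponent_sum_word_power: "exponent_sum (word_power m w) = int m * exponent_sum w"
  by (induction m) (simp_all add: algebra_simps)

lemma strand_pos_word_power: "strand_pos (word_power m w) = strand_pos w ^^ m"
  by (induction m) (auto simp: strand_pos_append funpow_swap1)

lemma crossings_word_power:
  "crossings (word_power m w) p q =
     (\<Sum>j<m. crossings w ((strand_pos w ^^ j) p) ((strand_pos w ^^ j) q))"
proof (induction m arbitrary: p q)
  case (Suc m)
  then show ?case
    by (simp add: crossings_append sum.lessThan_Suc_shift funpow_Suc_right
        del: sum.lessThan_Suc funpow.simps(2))
qed simp

text \<open>All words that represent a power of the full twist in the sphere braid group have this property, that is, all words
  that are trivial in the mapping class group.\<close>

definition twist_like :: "nat \<Rightarrow> nat word \<Rightarrow> bool" where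
  "twist_like n w \<longleftrightarrow> (\<forall>p\<in>{1..n}. strand_pos w p = p) \<and> vertex_sum n (crossings w)"

lemma twist_like_cong:
  assumes "same_crossings n u v"
  shows "twist_like n u \<longleftrightarrow> twist_like n v"
proof -
  have d: "vertex_sum n (\<lambda>p q. crossings u p q - crossings v p q)"
    and eq: "strand_pos u = strand_pos v"
    using assms by (simp_all add: same_crossings_def)
  have "vertex_sum n (crossings u) \<longleftrightarrow> vertex_sum n (crossings v)"
    using vertex_sum_add[OF d, of "crossings v"]
      vertex_sum_add[OF vertex_sum_uminus[OF d], of "crossings u"] by auto
  with eq show ?thesis by (simp add: twist_like_def)
qed

lemma twist_like_append:
  assumes "twist_like n u" "twist_like n v"
  shows "twist_like n (u @ v)"
proof -
  have "vertex_sum n (\<lambda>p q. crossings u p q + crossings v p q)"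
    using assms by (intro vertex_sum_add) (auto simp: twist_like_def)
  then have "vertex_sum n (crossings (u @ v))"
    by (rule vertex_sum_cong) (use assms in \<open>auto simp: twist_like_def crossings_append\<close>)
  then show ?thesis using assms by (auto simp: twist_like_def strand_pos_append)
qed

lemma twist_like_left_factor:
  assumes "twist_like n (u @ v)" "twist_like n v" "u \<in> words {1..<n}"
  shows "twist_like n u"
proof -
  have pos: "strand_pos u p = p" if "p \<in> {1..n}" for p
  proof -
    have "strand_pos u p \<in> {1..n}"
      using that permutes_in_image[OF strand_pos_permutes[OF assms(3)]] by blast
    then have "strand_pos v (strand_pos u p) = strand_pos u p"
      using assms(2) by (simp add: twist_like_def)
    then show ?thesis using assms(1) that by (simp add: twist_like_def strand_pos_append)
  qed
  have "vertex_sum n (\<lambda>p q. crossings (u @ v) p q + - crossings v p q)"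
    using assms by (intro vertex_sum_add vertex_sum_uminus) (auto simp: twist_like_def)
  then have "vertex_sum n (crossings u)"
    by (rule vertex_sum_cong) (simp add: pos crossings_append)
  with pos show ?thesis by (simp add: twist_like_def)
qed

text \<open>The permutation of \<open>rot n\<close> is the cyclic shift by \<open>-1\<close>, so its \<open>n\<close>-th power is the identity.\<close>

lemma rot_funpow:
  assumes "1 \<le> p" "p \<le> n" "k \<le> n"
  shows "(strand_pos (sigma_word [1..<n]) ^^ k) p = (if k < p then p - k else p + n - k)"
  using assms(3)
proof (induction k)
  case (Suc k)
  have "1 \<le> n" using assms by simp
  have "(strand_pos (sigma_word [1..<n]) ^^ Suc k) p =
      strand_pos (sigma_word [1..<n]) (if k < p then p - k else p + n - k)"
    using Suc by simp
  then show ?case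
    unfolding strand_pos_rot[OF \<open>1 \<le> n\<close>] using assms Suc.prems by auto
qed (use assms in simp)

text \<open>Already a single factor \<open>\<sigma>\<^sub>1 \<dots> \<sigma>\<^sub>n\<^sub>-\<^sub>1\<close> has crossing numbers \<open>t p + t q\<close>: strand \<open>1\<close> crosses each
  other strand once, so \<open>t\<close> is the indicator function of \<open>1\<close>.\<close>

lemma twist_like_full_twist:
  assumes "1 \<le> n"
  shows "twist_like n (word_power n (sigma_word [1..<n]))"
proof -
  let ?d = "sigma_word [1..<n]"
  have w: "?d \<in> words {1..<n}" by simp
  have "vertex_sum n (crossings ?d)"
    unfolding vertex_sum_def crossings_rot[OF assms]
    by (intro exI[of _ "\<lambda>p. if p = 1 then 1 else 0"]) auto
  then have "vertex_sum n (crossings (word_power m ?d))" for m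
  proof (induction m)
    case (Suc m)
    then have "vertex_sum n (\<lambda>p q. crossings ?d p q + 
        crossings (word_power m ?d) (strand_pos ?d p) (strand_pos ?d q))"
      using vertex_sum_permute strand_pos_permutes[OF w] by (intro vertex_sum_add) blast+
    then show ?case by (rule vertex_sum_cong) (simp add: crossings_append)
  next
    case 0
    show ?case by (rule vertex_sum_cong[OF vertex_sum_zero]) simp
  qed
  then show ?thesis
    using rot_funpow[of _ n n] by (simp add: twist_like_def strand_pos_word_power)
qed

text \<open>Let \<open>C p q = t p + t q\<close> be the crossing numbers of the power. Between two fixed strands, \<open>C\<close> is
  \<open>m\<close> times the crossing number of \<open>w\<close>, so the three fixed strands determine \<open>t a\<close>. The row sum of \<open>C\<close> at \<open>a\<close>
  then determines the sum \<open>T\<close> of all values of \<open>t\<close>, and the total of \<open>C\<close>, which is \<open>(n - 1) T\<close>, is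
  \<open>m\<close> times the exponent sum. That \<open>n\<close> is even makes \<open>(n - 2)/2\<close> an integer, as both conclusions require.\<close>

lemma periodic_word_three_fixed_strands:
  assumes n: "even n" and w: "w \<in> words {1..<n}" and m: "m > 0"
    and tw: "twist_like n (word_power m w)"
    and abc: "a \<in> {1..n}" "b \<in> {1..n}" "c \<in> {1..n}" "a \<noteq> b" "a \<noteq> c" "b \<noteq> c"
    and fixed: "strand_pos w a = a" "strand_pos w b = b" "strand_pos w c = c"
  shows "int n - 1 dvd exponent_sum w" "even (exponent_sum w)"
proof -
  let ?A = "{1..n}" and ?f = "strand_pos w"
  define C where "C = crossings (word_power m w)"
  obtain t where t: "\<And>p q. \<lbrakk>p \<in> ?A; q \<in> ?A; p \<noteq> q\<rbrakk> \<Longrightarrow> C p q = t p + t q"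
    using tw unfolding twist_like_def vertex_sum_def C_def by blast
  define T where "T = sum t ?A"
  have row: "(\<Sum>q\<in>?A. C p q) = (int n - 2) * t p + T" if "p \<in> ?A" for p
  proof -
    have "(\<Sum>q\<in>?A. C p q) = (\<Sum>q\<in>?A - {p}. C p q)"
      using that by (intro sum.mono_neutral_right) (auto simp: C_def)
    also have "\<dots> = (\<Sum>q\<in>?A - {p}. t p + t q)"
      using t that by (intro sum.cong) auto
    also have "\<dots> = (int n - 1) * t p + (T - t p)"
      using that by (simp add: sum.distrib sum_diff1 T_def of_nat_diff)
    finally show ?thesis by (simp add: algebra_simps)
  qed
  have fix_pow: "(?f ^^ j) x = x" if "?f x = x" for x j using that by (induction j) auto
  have pair: "C x y = int m * crossings w x y" if "?f x = x" "?f y = y" for x y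
    using that by (simp add: C_def crossings_word_power fix_pow)
  define S where "S = (\<Sum>q\<in>?A. crossings w a q)"
  have "(\<Sum>q\<in>?A. C a q) = (\<Sum>j<m. \<Sum>q\<in>?A. crossings w a ((?f ^^ j) q))"
    by (subst sum.swap) (simp add: C_def crossings_word_power fix_pow fixed)
  also have "\<dots> = int m * S"
    using sum_permute_index[OF permutes_funpow[OF strand_pos_permutes[OF w]]]
    by (simp add: S_def)
  \<comment> \<open>The powers of \<open>w\<close> permute the other strands, so each of them contributes the same row sum \<open>S\<close>.\<close>
  finally have rowS: "(int n - 2) * t a + T = int m * S" using row[OF abc(1)] by simp
  have "2 * (int m * exponent_sum w) = (\<Sum>p\<in>?A. \<Sum>q\<in>?A. C p q)"
    using sum_crossings[OF word_power_in_words[OF w]] by (simp add: C_def exponent_sum_word_power)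
  also have "\<dots> = (\<Sum>p\<in>?A. (int n - 2) * t p + T)"
    using row by (intro sum.cong) auto
  also have "\<dots> = (int n - 2) * T + int n * T"
    by (simp add: sum.distrib T_def flip: sum_distrib_left)
  finally have total: "int m * exponent_sum w = (int n - 1) * T"
    by (simp add: algebra_simps)
  \<comment> \<open>Solving the three equations \<open>t x + t y = m * crossings w x y\<close> for \<open>t a\<close>.\<close>
  define X where "X = crossings w a b + crossings w a c - crossings w b c"
  obtain l where "n = 2 * l" using n by (rule evenE)
  then obtain r where r: "int n - 2 = 2 * r" by (intro that[of "int l - 1"]) simp
  have "2 * t a = int m * X"
    using t[of a b] t[of a c] t[of b c] pair[of a b] pair[of a c] pair[of b c] abc fixed
    by (simp add: X_def algebra_simps)
  then have "(int n - 2) * t a = int m * (r * X)" unfolding r by simp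
  with rowS have "T = int m * (S - r * X)" by (simp add: algebra_simps)
  with total have "int m * exponent_sum w = int m * ((int n - 1) * (S - r * X))" by simp
  then have E: "exponent_sum w = (int n - 1) * (S - r * X)" using m by simp
  then show "int n - 1 dvd exponent_sum w" by simp
  \<comment> \<open>A fixed strand returns to its position, and two fixed strands keep their order.\<close>
  have "even S" using crossings_row_parity[OF w, of a] fixed by (simp add: S_def)
  moreover have "even X"
    using crossings_pair_parity[of a b w] crossings_pair_parity[of a c w]
      crossings_pair_parity[of b c w] abc fixed by (simp add: X_def)
  ultimately show "even (exponent_sum w)" using E by simp
qed

lemma periodic_word_few_fixed_strands:
  assumes n: "even n" and w: "w \<in> words {1..<n}" and m: "m > 0"
    and tw: "twist_like n (word_power m w)"
    and e: "odd (exponent_sum w) \<or> \<not> int n - 1 dvd exponent_sum w"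
  shows "card {q \<in> {1..n}. strand_pos w q = q} \<le> 2"
proof (rule ccontr)
  assume "\<not> ?thesis"
  then have "3 \<le> card {q \<in> {1..n}. strand_pos w q = q}" by simp
  then obtain F where "F \<subseteq> {q \<in> {1..n}. strand_pos w q = q}" "card F = 3"
    by (meson obtain_subset_with_card_n)
  then obtain a b c where "{a, b, c} \<subseteq> {q \<in> {1..n}. strand_pos w q = q}" 
    "a \<noteq> b" "a \<noteq> c" "b \<noteq> c"
    by (auto simp: card_3_iff)
  then show False
    using periodic_word_three_fixed_strands[OF n w m tw, of a b c] e by auto
qed

text \<open>For each prime \<open>r\<close>, the exponent \<open>m\<close> splits as \<open>r ^ b * k\<close> with \<open>k\<close> prime to \<open>r\<close>; the \<open>k\<close>-th power of \<open>w\<close>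
  then has \<open>r\<close>-power order, and its exponent sum is divisible by \<open>r\<close> only if that of \<open>w\<close> is. This is applied to \<open>r = 2\<close> and to an
  odd prime factor of \<open>n - 1\<close>; the fixed points of these two powers contradict each other.\<close>

theorem periodic_word_exponent:
  assumes n: "even n" "3 \<le> n" and w: "w \<in> words {1..<n}" and m: "m > 0"
    and tw: "twist_like n (word_power m w)"
  obtains "even (exponent_sum w)"
    | p where "prime p" "p dvd n - 1" "int p dvd exponent_sum w"
proof (cases "odd (exponent_sum w) \<and> (\<forall>p. prime p \<longrightarrow> p dvd n - 1 \<longrightarrow> \<not> int p dvd exponent_sum w)")
  case True
  let ?f = "strand_pos w" and ?A = "{1..n}"
  obtain p where p: "prime p" "p dvd n - 1"
  proof -
    have "n - 1 \<noteq> 1" using n(2) by simp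
    then show thesis using prime_factor_nat[of "n - 1"] that by blast
  qed
  then have pe: "\<not> int p dvd exponent_sum w" using True by blast
  have odd: "odd (n - 1)" using n by simp
  then have "p \<noteq> 2" using p(2) by auto
  then have p3: "3 \<le> p" using prime_ge_2_nat[OF p(1)] by simp
  have perm: "?f ^^ k permutes ?A" for k
    using strand_pos_permutes[OF w] by (rule permutes_funpow)
  have per: "(?f ^^ m) q = q" if "q \<in> ?A" for q
    using tw that by (simp add: twist_like_def strand_pos_word_power)
  have split: "\<exists>k b. m = r ^ b * k \<and> \<not> r dvd k" if "prime r" for r
    using multiplicity_decompose'[of m r] that m by (metis not_prime_unit neq0_conv)
  define Fix where "Fix k = {q \<in> ?A. (?f ^^ k) q = q}" for k
  have card_le: "card (Fix k) \<le> 2"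
    if "m = l * k" "odd (exponent_sum (word_power k w)) \<or> \<not> int n - 1 dvd exponent_sum (word_power k w)" 
    for k l
    unfolding Fix_def strand_pos_word_power[symmetric]
    using periodic_word_few_fixed_strands[OF n(1) word_power_in_words[OF w] _ _ that(2), of l] m tw
    by (simp add: word_power_mult that(1))
  have cong: "[card (Fix k) = n] (mod r)" if "prime r" "m = r ^ b * k" for k r b
  proof -
    have "[card (Fix k) = card ?A] (mod r)"
      unfolding Fix_def
    proof (rule card_fixpoints_prime_power_cong[OF that(1)])
      show "(?f ^^ k) ` ?A \<subseteq> ?A" using permutes_image[OF perm] by simp
      show "((?f ^^ k) ^^ (r ^ b)) q = q" if "q \<in> ?A" for q
        using per[OF that] \<open>m = r ^ b * k\<close> by (simp add: funpow_mult mult.commute)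
    qed simp
    then show ?thesis by simp
  qed
  \<comment> \<open>\<open>w\<close> to the power \<open>k\<close> is the \<open>p\<close>-part \<open>z\<close>, and to the power \<open>l\<close> the \<open>2\<close>-part \<open>y\<close>.\<close>
  obtain k b where k: "m = p ^ b * k" "\<not> p dvd k" using split[OF p(1)] by blast
  obtain l d where l: "m = 2 ^ d * l" "\<not> 2 dvd l" using split[OF two_is_prime_nat] by blast
  have "\<not> int p dvd exponent_sum (word_power k w)"
    using k(2) pe p(1) by (simp add: exponent_sum_word_power prime_dvd_mult_iff)
  moreover have "int p dvd int n - 1"
  proof -
    have "int (n - 1) = int n - 1" using n(2) by simp
    then show ?thesis using p(2) by (metis of_nat_dvd_iff)
  qed
  ultimately have "card (Fix k) \<le> 2" using card_le[OF k(1)] dvd_trans by blast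
  moreover have "[n = 1] (mod p)"
  proof -
    from p(2) obtain j where "n - 1 = p * j" by (rule dvdE)
    then have "n = 1 + p * j" using n(2) by simp
    then show ?thesis unfolding cong_def by (simp only: mod_mult_self2)
  qed
  then have "[card (Fix k) = 1] (mod p)" using cong[OF p(1) k(1)] cong_trans by blast
  ultimately have "card (Fix k) = 1"
    using p3 by (auto simp: cong_def)
  then obtain f0 where f0: "Fix k = {f0}" by (rule card_1_singletonE)
  \<comment> \<open>Powers of one permutation preserve the fixed points of each other.\<close>
  have commute: "(?f ^^ i) ((?f ^^ j) q) = (?f ^^ j) ((?f ^^ i) q)" for i j q
    by (metis add.commute comp_apply funpow_add)
  have stable: "(?f ^^ i) q \<in> Fix j" if "q \<in> Fix j" for i j q
    using that permutes_in_image[OF perm] commute by (auto simp: Fix_def)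
  have inj: "(?f ^^ i) q = (?f ^^ i) q' \<longleftrightarrow> q = q'" for i q q'
    using permutes_inj[OF perm] by (rule inj_eq)
  have "(?f ^^ l) f0 = f0" using stable[of f0 k l] f0 by simp
  then have f0l: "f0 \<in> Fix l" using f0 by (auto simp: Fix_def)
  have "odd (exponent_sum (word_power l w))"
    using l(2) True by (simp add: exponent_sum_word_power)
  then have "card (Fix l) \<le> 2" using card_le[OF l(1)] by blast
  moreover have "even (card (Fix l))"
    using cong[OF two_is_prime_nat l(1)] n(1) by (simp add: cong_def even_iff_mod_2_eq_zero)
  moreover have "card (Fix l) \<noteq> 0" using f0l by (auto simp: Fix_def)
  ultimately have "card (Fix l) = 2" by (auto elim!: evenE)
  then obtain x y where xy: "Fix l = {x, y}" "x \<noteq> y" by (auto simp: card_2_iff)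
  define g where "g = (if f0 = x then y else x)"
  have g: "g \<in> Fix l" "g \<noteq> f0" "Fix l = {f0, g}"
    using xy f0l by (auto simp: g_def)
  have "(?f ^^ k) f0 = f0" using f0 by (auto simp: Fix_def)
  then have "(?f ^^ k) g = g"
    using stable[OF g(1), of k] g inj[of k g f0] by auto
  then have "g \<in> Fix k" using g(1) by (auto simp: Fix_def)
  then show ?thesis using f0 g(2) by simp
qed (use that in blast)

section \<open>The sphere braid group modulo the full twist\<close>

lemma (in group) commute_generate:
  assumes "x \<in> carrier G" "S \<subseteq> carrier G" "\<And>y. y \<in> S \<Longrightarrow> x \<otimes> y = y \<otimes> x"
    and "y \<in> generate G S"
  shows "x \<otimes> y = y \<otimes> x"
  using assms(4)
proof (induction rule: generate.induct)
  case (inv y)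
  then have y: "y \<in> carrier G" using assms(2) by blast
  have "x \<otimes> inv y = inv y \<otimes> (y \<otimes> x) \<otimes> inv y"
    using assms(1) y by (simp add: m_assoc[symmetric])
  also have "\<dots> = inv y \<otimes> (x \<otimes> y) \<otimes> inv y"
    using assms(3)[OF inv] by simp
  also have "\<dots> = inv y \<otimes> x"
    using assms(1) y by (simp add: m_assoc)
  finally show ?case .
next
  case (eng y z)
  then have "y \<in> carrier G" "z \<in> carrier G"
    using generate_in_carrier[OF assms(2)] by auto
  then show ?case using eng assms(1) by (metis m_assoc)
qed (use assms in auto)

text \<open>A subgroup generated by a central element is central, hence normal; centrality need only be tested on
  generators.\<close>

lemma (in group) normal_generate_central:
  assumes c: "c \<in> carrier G" and S: "S \<subseteq> carrier G" "carrier G = generate G S"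
    and comm: "\<And>y. y \<in> S \<Longrightarrow> c \<otimes> y = y \<otimes> c"
  shows "generate G {c} \<lhd> G"
proof -
  have "c \<otimes> x = x \<otimes> c" if "x \<in> carrier G" for x
    using commute_generate[OF c S(1) comm] that S(2) by blast
  then have comm': "x \<otimes> z = z \<otimes> x" if "x \<in> carrier G" "z \<in> generate G {c}" for x z
    using commute_generate[of x "{c}" z] c that by auto
  have "x \<otimes> z \<otimes> inv x = z" if "x \<in> carrier G" "z \<in> generate G {c}" for x z
    unfolding comm'[OF that] using that generate_in_carrier[of "{c}" z] c by (simp add: m_assoc)
  then show ?thesis
    using c by (auto simp: normal_inv_iff generate_is_subgroup)
qed

definition sphere_sigma :: "nat \<Rightarrow> nat \<Rightarrow> nat word set" where
  "sphere_sigma n i = sphere_braid n [i]"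

lemma sphere_braid_group_braid_system:
  "braid_system (sphere_braid_group n) n (sphere_sigma n)"
proof -
  interpret group "sphere_braid_group n"
    unfolding sphere_braid_group_def by (rule group_presented_group)
  have mult: "sphere_braid n is \<otimes>\<^bsub>sphere_braid_group n\<^esub> sphere_braid n js = sphere_braid n (is @ js)"
    if "set is \<subseteq> {1..<n}" "set js \<subseteq> {1..<n}" for "is" js
    using that by (simp add: sphere_braid_def sphere_braid_group_def pres_class_mult sigma_word_append)
  have rel: "sphere_braid n is = sphere_braid n js"
    if "set is \<subseteq> {1..<n}" "set js \<subseteq> {1..<n}" "(sigma_word is, sigma_word js) \<in> sphere_braid_rels n"
    for "is" js
    unfolding sphere_braid_def using that by (simp add: pres_class_eq pres_eq_rel)
  show ?thesis
  proof
    show "sphere_sigma n i \<in> carrier (sphere_braid_group n)" if "1 \<le> i" "i < n" for i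
      using that by (simp add: sphere_sigma_def sphere_braid_def sphere_braid_group_def)
  next
    fix i j assume ij: "1 \<le> i" "i + 2 \<le> j" "j < n"
    then have "(sigma_word [i, j], sigma_word [j, i]) \<in> sphere_braid_rels n"
      unfolding sphere_braid_rels_def by fastforce
    then have "sphere_braid n [i, j] = sphere_braid n [j, i]" using ij by (intro rel) auto
    then show "sphere_sigma n i \<otimes>\<^bsub>sphere_braid_group n\<^esub> sphere_sigma n j =
        sphere_sigma n j \<otimes>\<^bsub>sphere_braid_group n\<^esub> sphere_sigma n i"
      using ij by (simp add: sphere_sigma_def mult)
  next
    fix i assume i: "1 \<le> i" "i + 1 < n"
    then have "(sigma_word [i, i + 1, i], sigma_word [i + 1, i, i + 1]) \<in> sphere_braid_rels n"
      unfolding sphere_braid_rels_def by fastforce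
    then have "sphere_braid n [i, i + 1, i] = sphere_braid n [i + 1, i, i + 1]"
      using i by (intro rel) auto
    then show "sphere_sigma n i \<otimes>\<^bsub>sphere_braid_group n\<^esub>
          (sphere_sigma n (i + 1) \<otimes>\<^bsub>sphere_braid_group n\<^esub> sphere_sigma n i) =
        sphere_sigma n (i + 1) \<otimes>\<^bsub>sphere_braid_group n\<^esub>
          (sphere_sigma n i \<otimes>\<^bsub>sphere_braid_group n\<^esub> sphere_sigma n (i + 1))"
      using i by (simp add: sphere_sigma_def mult)
  qed
qed

locale marked_sphere =
  fixes n :: nat
  assumes three_le: "3 \<le> n"
begin

abbreviation B where "B \<equiv> sphere_braid_group n"
abbreviation rels where "rels \<equiv> sphere_braid_rels n"

sublocale B: braid_system B n "sphere_sigma n"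
  by (rule sphere_braid_group_braid_system)

lemma B_def: "B = presented_group {1..<n} rels"
  by (simp add: sphere_braid_group_def)

lemma sphere_braid_eq_word: "set is \<subseteq> {1..<n} \<Longrightarrow> sphere_braid n is = B.word is"
proof (induction "is")
  case (Cons i "is")
  have "sphere_braid n (i # is) = sphere_sigma n i \<otimes>\<^bsub>B\<^esub> sphere_braid n is"
    using Cons.prems by (simp add: sphere_sigma_def sphere_braid_def B_def pres_class_mult)
  then show ?case using Cons by simp
next
  case Nil
  have "sphere_braid n [] = \<one>\<^bsub>B\<^esub>"
    by (simp add: sphere_braid_def B_def one_presented_group)
  then show ?case by simp
qed

lemma sphere_relation: "B.word ([1..<n] @ rev [1..<n]) = \<one>\<^bsub>B\<^esub>"
proof -
  have "pres_eq {1..<n} rels (sigma_word ([1..<n] @ rev [1..<n])) []"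
    by (rule pres_eq_rel) (auto simp: sphere_braid_rels_def)
  then have "sphere_braid n ([1..<n] @ rev [1..<n]) = \<one>\<^bsub>B\<^esub>"
    unfolding sphere_braid_def B_def one_presented_group by (subst pres_class_eq) auto
  then show ?thesis by (simp add: sphere_braid_eq_word)
qed

lemma B_generated: "carrier B = generate B (sphere_sigma n ` {1..<n})"
  unfolding B_def presented_group_generated[of "{1..<n}" rels]
  by (simp add: sphere_sigma_def[abs_def] sphere_braid_def sigma_word_def)

lemma full_twist_eq: "sphere_full_twist n = B.rot n [^]\<^bsub>B\<^esub> n"
  by (simp add: sphere_full_twist_def sphere_braid_eq_word B.rot_def)

lemma class_word_power:
  assumes "w \<in> words {1..<n}"
  shows "pres_class {1..<n} rels (word_power m w) = pres_class {1..<n} rels w [^]\<^bsub>B\<^esub> m"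
proof (induction m)
  case (Suc m)
  have "pres_class {1..<n} rels (word_power (Suc m) w) = 
      pres_class {1..<n} rels w \<otimes>\<^bsub>B\<^esub> pres_class {1..<n} rels (word_power m w)"
    using assms by (simp add: B_def pres_class_mult word_power_in_words)
  then show ?case
    using Suc B.nat_pow_Suc2[of "pres_class {1..<n} rels w" m] assms by (simp add: B_def)
qed (simp add: B_def one_presented_group)

lemma full_twist_class:
  "sphere_full_twist n = pres_class {1..<n} rels (word_power n (sigma_word [1..<n]))"
  using class_word_power[of "sigma_word [1..<n]" n]
  by (simp add: sphere_full_twist_def sphere_braid_def)

abbreviation N where "N \<equiv> twist_subgroup n"

lemma full_twist_closed: "sphere_full_twist n \<in> carrier B"
  by (simp add: full_twist_eq)

lemma N_normal: "N \<lhd> B"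
  unfolding twist_subgroup_def
proof (rule B.normal_generate_central[OF full_twist_closed _ B_generated])
  show "sphere_full_twist n \<otimes>\<^bsub>B\<^esub> y = y \<otimes>\<^bsub>B\<^esub> sphere_full_twist n" if "y \<in> sphere_sigma n ` {1..<n}" for y
    using that B.full_twist_commute by (auto simp: full_twist_eq)
qed auto

lemma full_twist_in_N: "sphere_full_twist n \<in> N"
  unfolding twist_subgroup_def by (rule generate.incl) simp

abbreviation M where "M \<equiv> braid_mcg n"

abbreviation proj where "proj x \<equiv> N #>\<^bsub>B\<^esub> x"

lemma group_M: "group M"
  unfolding braid_mcg_def by (rule normal.factorgroup_is_group[OF N_normal])

lemma proj_hom: "(\<lambda>x. proj x) \<in> hom B M"
  unfolding braid_mcg_def by (rule normal.r_coset_hom_Mod[OF N_normal])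

lemma carrier_M: "carrier M = (\<lambda>x. proj x) ` carrier B"
  by (simp add: braid_mcg_def carrier_FactGroup)

lemma one_M: "\<one>\<^bsub>M\<^esub> = N"
  by (simp add: braid_mcg_def)

lemma proj_eq_one_iff: "x \<in> carrier B \<Longrightarrow> proj x = \<one>\<^bsub>M\<^esub> \<longleftrightarrow> x \<in> N"
  unfolding one_M
  using B.coset_join2[OF _ normal_imp_subgroup[OF N_normal]]
    B.rcos_self[OF _ normal_imp_subgroup[OF N_normal]] by auto

lemma M_sphere_mcg_system: "sphere_mcg_system M n ((\<lambda>x. proj x) \<circ> sphere_sigma n)"
proof (rule B.sphere_mcg_system_image[OF group_M proj_hom _ three_le _ _ B_generated])
  interpret h: group_hom B M "\<lambda>x. proj x"
    using group_M proj_hom by (simp add: group_hom_def group_hom_axioms_def B.is_group)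
  show "proj (B.word ([1..<n] @ rev [1..<n])) = \<one>\<^bsub>M\<^esub>"
    unfolding sphere_relation by (rule h.hom_one)
  show "proj (B.rot n [^]\<^bsub>B\<^esub> n) = \<one>\<^bsub>M\<^esub>"
    using proj_eq_one_iff[OF full_twist_closed] full_twist_in_N by (simp add: full_twist_eq)
qed (simp add: carrier_M)

sublocale M: sphere_mcg_system M n "(\<lambda>x. proj x) \<circ> sphere_sigma n"
  by (rule M_sphere_mcg_system)

lemma alpha_eq:
  "braid_mcg_alpha n 0 = M.rot n"
  "braid_mcg_alpha n 1 = M.rot1 n"
  "braid_mcg_alpha n 2 = M.rot1 (n - 1)"
proof -
  have rot: "proj (B.rot m) = M.rot m" if "m \<le> n" for m
    using B.rot_image[OF group_M proj_hom that] by simp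
  have rot1: "proj (sphere_braid n ([1..<m] @ [m - 1])) = M.rot1 m" if "2 \<le> m" "m \<le> n" for m
  proof -
    have "sphere_braid n ([1..<m] @ [m - 1]) = B.word ([1..<m] @ [m - 1])"
      using that by (intro sphere_braid_eq_word) auto
    also have "\<dots> = B.word [1..<m] \<otimes>\<^bsub>B\<^esub> B.word [m - 1]"
      using that by (intro B.word_append) auto
    finally have "sphere_braid n ([1..<m] @ [m - 1]) = B.rot m \<otimes>\<^bsub>B\<^esub> sphere_sigma n (m - 1)"
      using that by (simp add: B.rot_def)
    then show ?thesis
      using that hom_mult[OF proj_hom, of "B.rot m" "sphere_sigma n (m - 1)"] rot[of m] by simp
  qed
  show "braid_mcg_alpha n 0 = M.rot n"
    using rot[of n] by (simp add: braid_mcg_alpha_def sphere_alpha_def sphere_braid_eq_word B.rot_def)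
  show "braid_mcg_alpha n 1 = M.rot1 n"
    using rot1[of n] three_le by (simp add: braid_mcg_alpha_def sphere_alpha_def)
  show "braid_mcg_alpha n 2 = M.rot1 (n - 1)"
    using rot1[of "n - 1"] three_le 
    by (simp add: braid_mcg_alpha_def sphere_alpha_def numeral_2_eq_2)
qed

text \<open>A map on the generators that respects the relations of the sphere braid group and kills the full twist
  induces a homomorphism on the mapping class group.\<close>

lemma hom_M_if_von_Dyck:
  assumes "group H" and f: "f \<in> {1..<n} \<rightarrow> carrier H"
    and rels: "\<And>u v. (u, v) \<in> rels \<Longrightarrow> eval_word H f u = eval_word H f v"
    and twist: "eval_word H f (word_power n (sigma_word [1..<n])) = \<one>\<^bsub>H\<^esub>"
  obtains h where "h \<in> hom M H" 
    "\<And>w. w \<in> words {1..<n} \<Longrightarrow> h (proj (pres_class {1..<n} rels w)) = eval_word H f w"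
proof -
  interpret H: group H by fact
  obtain g where g: "g \<in> hom B H"
    "\<And>w. w \<in> words {1..<n} \<Longrightarrow> g (pres_class {1..<n} rels w) = eval_word H f w"
    using H.von_Dyck[OF f rels] unfolding B_def by blast
  interpret g: group_hom B H g
    using g(1) by (simp add: group_hom_def group_hom_axioms_def B.is_group H.is_group)
  have "g (sphere_full_twist n) = \<one>\<^bsub>H\<^esub>"
    using g(2)[of "word_power n (sigma_word [1..<n])"] twist by (simp add: full_twist_class word_power_in_words)
  then have "sphere_full_twist n \<in> kernel B H g"
    using full_twist_closed by (simp add: kernel_def)
  then have "N \<subseteq> kernel B H g"
    unfolding twist_subgroup_def
    by (intro B.generate_subgroup_incl[OF _ g.subgroup_kernel]) simp
  then obtain h where h: "h \<in> hom M H" "\<And>x. x \<in> carrier B \<Longrightarrow> h (proj x) = g x"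
    using g.FactGroup_universal_kernel[OF N_normal] unfolding braid_mcg_def by blast
  show thesis
    using h(2) g(2) by (intro that[OF h(1)]) (simp add: B_def)
qed

lemma M_generator: "((\<lambda>x. proj x) \<circ> sphere_sigma n) i = proj (pres_class {1..<n} rels [(i, True)])"
  by (simp add: sphere_sigma_def sphere_braid_def)

text \<open>The relators of the mapping class group that are not homogeneous are the sphere relator and the full twist,
  of lengths \<open>2 (n - 1)\<close> and \<open>n (n - 1)\<close>.\<close>

lemma length_hom:
  assumes k: "0 < k" "k dvd 2 * (n - 1)" "k dvd n * (n - 1)"
  obtains h where "h \<in> hom M (integer_mod_group k)"
    "\<And>w. w \<in> words {1..<n} \<Longrightarrow> h (proj (pres_class {1..<n} rels w)) = exponent_sum w mod int k"
proof -
  let ?Z = "integer_mod_group k" and ?f = "\<lambda>_::nat. 1 mod int k"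
  have f: "1 mod int k \<in> carrier ?Z" using k(1) by (simp add: carrier_integer_mod_group)
  have eval: "eval_word ?Z ?f w = exponent_sum w mod int k" for w
  proof (induction w)
    case (Cons l w)
    obtain i b where l: "l = (i, b)" by force
    have "inv\<^bsub>?Z\<^esub> (?f i) = - 1 mod int k"
      using inv_integer_mod_group[OF f] by (simp add: mod_minus_eq)
    then show ?case using Cons l by (simp add: mod_add_eq)
  qed simp
  have len: "exponent_sum (sigma_word is) = int (length is)" for "is"
    by (induction "is") auto
  obtain h where "h \<in> hom M ?Z"
    "\<And>w. w \<in> words {1..<n} \<Longrightarrow> h (proj (pres_class {1..<n} rels w)) = eval_word ?Z ?f w"
  proof (rule hom_M_if_von_Dyck)
    show "eval_word ?Z ?f u = eval_word ?Z ?f v" if "(u, v) \<in> rels" for u v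
    proof -
      have "int k dvd int (2 * (n - 1))" using k(2) by (simp only: of_nat_dvd_iff)
      then have zero: "int (2 * (n - 1)) mod int k = 0" by simp
      have sum: "exponent_sum (sigma_word ([1..<n] @ rev [1..<n])) = int (2 * (n - 1))"
        unfolding len by simp
      from that show ?thesis
      proof (cases rule: sphere_braid_rels_cases)
        case sphere
        then show ?thesis unfolding eval by (simp only: sum zero) simp
      qed (simp_all add: eval)
    qed
    have "int k dvd int (n * (n - 1))" using k(3) by (simp only: of_nat_dvd_iff)
    then have "int (n * (n - 1)) mod int k = 0" by simp
    moreover have "exponent_sum (word_power n (sigma_word [1..<n])) = int (n * (n - 1))"
      unfolding exponent_sum_word_power len by simp
    ultimately show "eval_word ?Z ?f (word_power n (sigma_word [1..<n])) = \<one>\<^bsub>?Z\<^esub>"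
      unfolding eval by simp
  qed (use f in auto)
  then show thesis using that by (simp add: eval)
qed

lemma M_has_length_hom:
  assumes "0 < k" "k dvd 2 * (n - 1)" "k dvd n * (n - 1)"
  shows "M.has_length_hom k"
proof -
  obtain h where h: "h \<in> hom M (integer_mod_group k)"
    "\<And>w. w \<in> words {1..<n} \<Longrightarrow> h (proj (pres_class {1..<n} rels w)) = exponent_sum w mod int k"
    using length_hom[OF assms] by blast
  show ?thesis
    unfolding M.has_length_hom_def M_generator
  proof (intro bexI[OF _ h(1)] allI impI)
    show "h (proj (pres_class {1..<n} rels [(i, True)])) = 1 mod int k" if "1 \<le> i" "i < n" for i
      using h(2)[of "[(i, True)]"] that by simp
  qed
qed

lemma in_N_imp_twist_like_representative:
  assumes "X \<in> N"
  shows "\<exists>w\<in>words {1..<n}. X = pres_class {1..<n} rels w \<and> twist_like n w"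
  using assms unfolding twist_subgroup_def
proof (induction rule: generate.induct)
  case one
  have "twist_like n []"
    using vertex_sum_cong[OF vertex_sum_zero, of n "crossings []"] by (simp add: twist_like_def)
  then show ?case by (intro bexI[of _ "[]"]) (auto simp: B_def one_presented_group)
next
  case (incl h)
  have "twist_like n (word_power n (sigma_word [1..<n]))"
    by (rule twist_like_full_twist) (use three_le in simp)
  moreover have "word_power n (sigma_word [1..<n]) \<in> words {1..<n}"
    by (simp add: word_power_in_words)
  ultimately show ?case using incl full_twist_class by blast
next
  case (inv h)
  let ?w = "word_power n (sigma_word [1..<n])"
  have w: "?w \<in> words {1..<n}" by (simp add: word_power_in_words)
  have "twist_like n []"
    using vertex_sum_cong[OF vertex_sum_zero, of n "crossings []"] by (simp add: twist_like_def)
  then have "twist_like n (inverse_word ?w @ ?w)"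
    using same_crossings_if_pres_eq[OF pres_eq_inverse_word[OF w]] three_le twist_like_cong by simp
  moreover have "twist_like n ?w"
    by (rule twist_like_full_twist) (use three_le in simp)
  ultimately have tw: "twist_like n (inverse_word ?w)"
    using inverse_word_in_words[OF w] by (rule twist_like_left_factor)
  have "inv\<^bsub>B\<^esub> h = pres_class {1..<n} rels (inverse_word ?w)"
    using inv inv_pres_class[OF w, of rels] by (simp add: full_twist_class B_def)
  with tw show ?case using inverse_word_in_words[OF w] by blast
next
  case (eng h1 h2)
  then obtain u v where uv: "u \<in> words {1..<n}" "h1 = pres_class {1..<n} rels u" "twist_like n u"
    "v \<in> words {1..<n}" "h2 = pres_class {1..<n} rels v" "twist_like n v"
    by blast
  then show ?case
    by (intro bexI[of _ "u @ v"]) (simp_all add: B_def pres_class_mult twist_like_append)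
qed

lemma twist_like_if_in_N:
  assumes "w \<in> words {1..<n}" "pres_class {1..<n} rels w \<in> N"
  shows "twist_like n w"
proof -
  obtain v where v: "pres_class {1..<n} rels w = pres_class {1..<n} rels v" "twist_like n v"
    using in_N_imp_twist_like_representative[OF assms(2)] by blast
  then have "pres_eq {1..<n} rels w v" using pres_class_eq[OF assms(1)] by blast
  then have "same_crossings n w v"
    by (rule same_crossings_if_pres_eq) (use three_le in simp)
  then show ?thesis using twist_like_cong v(2) by blast
qed

text \<open>A lift of \<open>x\<close> to a word has a power that is \<open>twist_like\<close>, so its exponent sum is even or shares a prime
  factor with \<open>n - 1\<close>. Such a prime \<open>p\<close> divides the lengths of the sphere relator and of the full twist (for
  \<open>p = 2\<close> because \<open>n\<close> is even), so that the exponent sum modulo \<open>p\<close> is defined on the group.\<close>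

theorem torsion_killed_mod_prime:
  assumes "even n" "torsion_element M x"
  obtains p h where "prime p" "h \<in> hom M (integer_mod_group p)" "h x = 0"
    "h (((\<lambda>x. proj x) \<circ> sphere_sigma n) 1) = 1"
proof -
  from assms(2) obtain m :: nat where x: "x \<in> carrier M" and m: "0 < m" "x [^]\<^bsub>M\<^esub> m = \<one>\<^bsub>M\<^esub>"
    unfolding torsion_element_def by blast
  from x obtain w where w: "w \<in> words {1..<n}" "x = proj (pres_class {1..<n} rels w)"
    unfolding carrier_M by (auto simp: B_def carrier_presented_group)
  have wB: "pres_class {1..<n} rels w \<in> carrier B" using w(1) by (simp add: B_def)
  have "proj (pres_class {1..<n} rels w [^]\<^bsub>B\<^esub> m) = \<one>\<^bsub>M\<^esub>"
    using m(2) normal.FactGroup_pow[OF N_normal wB] by (simp add: braid_mcg_def w(2))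
  then have "pres_class {1..<n} rels (word_power m w) \<in> N"
    unfolding class_word_power[OF w(1)]
    using proj_eq_one_iff[OF B.nat_pow_closed[OF wB, of m]] by simp
  then have tw: "twist_like n (word_power m w)"
    using w(1) by (intro twist_like_if_in_N) (simp_all add: word_power_in_words)
  obtain p where p: "prime p" "p dvd 2 * (n - 1)" "p dvd n * (n - 1)" "int p dvd exponent_sum w"
  proof (rule periodic_word_exponent[OF assms(1) three_le w(1) m(1) tw])
    assume "even (exponent_sum w)"
    then show thesis using assms(1) by (intro that[of 2]) auto
  next
    fix p assume "prime p" "p dvd n - 1" "int p dvd exponent_sum w"
    then show thesis by (intro that[of p]) auto
  qed
  have "0 < p" using p(1) by (rule prime_gt_0_nat)
  then obtain h where h: "h \<in> hom M (integer_mod_group p)"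
    "\<And>w. w \<in> words {1..<n} \<Longrightarrow> h (proj (pres_class {1..<n} rels w)) = exponent_sum w mod int p"
    using length_hom[OF _ p(2,3)] by blast
  show thesis
  proof (rule that[OF p(1) h(1)])
    show "h x = 0" using h(2)[OF w(1)] p(4) w(2) by simp
    show "h (((\<lambda>x. proj x) \<circ> sphere_sigma n) 1) = 1"
      unfolding M_generator using h(2)[of "[(1, True)]"] three_le prime_gt_1_nat[OF p(1)] by simp
  qed
qed

text \<open>Composed with the inverse of \<open>f\<close>, the homomorphism that kills the torsion element kills its normal closure but
  not the image of \<open>\<sigma>\<^sub>1\<close>.\<close>

theorem no_torsion_normal_generator:
  assumes "even n" "group H" "f \<in> iso M H" "torsion_element H x"
  shows "normal_closure H x \<noteq> carrier H"
proof
  assume eq: "normal_closure H x = carrier H"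
  interpret H: group H by fact
  let ?g = "inv_into (carrier M) f"
  have g: "?g \<in> iso H M" using M.iso_set_sym[OF assms(3)] .
  then interpret g: group_hom H M ?g
    by (simp add: group_hom_def group_hom_axioms_def iso_def H.is_group M.is_group)
  from assms(4) obtain m :: nat where x: "x \<in> carrier H" and m: "0 < m" "x [^]\<^bsub>H\<^esub> m = \<one>\<^bsub>H\<^esub>"
    unfolding torsion_element_def by blast
  have "?g x [^]\<^bsub>M\<^esub> m = \<one>\<^bsub>M\<^esub>"
    using g.hom_nat_pow[OF x, of m] m(2) g.hom_one by simp
  then have "torsion_element M (?g x)"
    using x m(1) unfolding torsion_element_def by auto
  then obtain p h where h: "prime p" "h \<in> hom M (integer_mod_group p)" "h (?g x) = 0"
    "h (((\<lambda>x. proj x) \<circ> sphere_sigma n) 1) = 1"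
    using torsion_killed_mod_prime[OF assms(1)] by blast
  have "h \<circ> ?g \<in> hom H (integer_mod_group p)"
    using g.homh h(2) by (rule hom_compose)
  then interpret hg: group_hom H "integer_mod_group p" "h \<circ> ?g"
    by (simp add: group_hom_def group_hom_axioms_def H.is_group)
  have s1: "((\<lambda>x. proj x) \<circ> sphere_sigma n) 1 \<in> carrier M"
    using three_le by (intro M.gen_closed) auto
  let ?y = "f (((\<lambda>x. proj x) \<circ> sphere_sigma n) 1)"
  have y: "?y \<in> carrier H" "?g ?y = ((\<lambda>x. proj x) \<circ> sphere_sigma n) 1"
    using assms(3) s1 by (auto simp: iso_def bij_betw_def inv_into_f_f)
  have "?y \<in> normal_closure H x" using eq y(1) by simp
  then have "(h \<circ> ?g) ?y = 0"
    using hg.normal_closure_subset_kernel[OF x] h(3) by (auto simp: kernel_def)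
  then show False using y(2) h(4) by simp
qed

end

section \<open>Three marked points\<close>

context sphere_mcg_system
begin

text \<open>Write \<open>a, b\<close> for the generators. The sphere relator \<open>abba\<close> says that \<open>a\<^sup>2\<close> is the inverse of \<open>b\<^sup>2\<close>, so it
  commutes with \<open>b\<close>. The full twist is \<open>(aba)(aba) = ab a\<^sup>2 ba = a b\<^sup>2 a\<^sup>2 a\<close>, which is therefore \<open>a\<^sup>2\<close>.\<close>

lemma three_points_squares:
  assumes "n = 3"
  shows "s 1 \<otimes> s 1 = \<one>" "s 2 \<otimes> s 2 = \<one>"
proof -
  define a b where "a = s 1" and "b = s 2"
  have c: "a \<in> carrier G" "b \<in> carrier G" using assms by (simp_all add: a_def b_def)
  have rot3: "rot n = a \<otimes> b"
    using c assms by (simp add: rot_def upt_conv_Cons numeral_2_eq_2 a_def b_def)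
  have sphere: "a \<otimes> (b \<otimes> (b \<otimes> a)) = \<one>"
    using sphere_relation c assms by (simp add: upt_conv_Cons numeral_2_eq_2 a_def b_def)
  have aba: "a \<otimes> (b \<otimes> a) = b \<otimes> (a \<otimes> b)"
    using braid[of 1] assms by (simp add: numeral_2_eq_2 a_def b_def)
  have "(a \<otimes> b) [^] (3::nat) = \<one>"
    using full_twist_trivial rot3 assms by simp
  then have twist: "(a \<otimes> (b \<otimes> a)) \<otimes> (b \<otimes> (a \<otimes> b)) = \<one>"
    using c by (simp add: numeral_3_eq_3 m_assoc)
  have "(a \<otimes> (b \<otimes> b)) \<otimes> a = \<one>" using sphere c by (simp add: m_assoc)
  then have "a \<otimes> (a \<otimes> (b \<otimes> b)) = \<one>"
    using c inv_comm[of "a \<otimes> (b \<otimes> b)" a] by simp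
  then have "(a \<otimes> a) \<otimes> (b \<otimes> b) = \<one>" using c by (simp add: m_assoc)
  then have uv: "a \<otimes> a = inv (b \<otimes> b)" using c by (simp add: inv_equality)
  define x where "x = b \<otimes> b"
  have x: "x \<in> carrier G" "x \<otimes> b = b \<otimes> x" using c by (simp_all add: x_def m_assoc)
  have "inv x \<otimes> b = inv x \<otimes> (b \<otimes> x) \<otimes> inv x"
    using x(1) c by (simp add: m_assoc)
  also have "\<dots> = inv x \<otimes> (x \<otimes> b) \<otimes> inv x" by (simp only: x(2))
  also have "\<dots> = b \<otimes> inv x"
    using x(1) c by (simp flip: m_assoc)
  finally have comm: "a \<otimes> a \<otimes> b = b \<otimes> (a \<otimes> a)" by (simp only: uv x_def)
  have "\<one> = a \<otimes> (b \<otimes> (a \<otimes> a \<otimes> b)) \<otimes> a"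
    using twist c unfolding aba[symmetric] by (simp add: m_assoc)
  also have "\<dots> = a \<otimes> ((b \<otimes> b) \<otimes> (a \<otimes> a)) \<otimes> a"
    unfolding comm using c by (simp add: m_assoc)
  also have "(b \<otimes> b) \<otimes> (a \<otimes> a) = \<one>"
    unfolding uv using c by simp
  also have "a \<otimes> \<one> \<otimes> a = a \<otimes> a"
    using c by simp
  finally show aa: "s 1 \<otimes> s 1 = \<one>" by (simp add: a_def)
  then have "inv (b \<otimes> b) = \<one>" using uv by (simp add: a_def)
  then show "s 2 \<otimes> s 2 = \<one>" using c by (simp add: b_def)
qed

lemma three_points_rot1_pred:
  assumes "n = 3"
  shows "rot1 (n - 1) = \<one>"
proof -
  have "rot (n - 1) = s 1" using assms by (simp add: rot_def upt_conv_Cons numeral_2_eq_2)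
  then show ?thesis using three_points_squares(1)[OF assms] assms by simp
qed

text \<open>The six elements are permuted by left multiplication with each generator, hence by every group element;
  and \<open>\<one>\<close> is one of them.\<close>

lemma three_points_elements:
  assumes "n = 3"
  shows "carrier G \<subseteq> {\<one>, s 1, s 2, s 1 \<otimes> s 2, s 2 \<otimes> s 1, s 1 \<otimes> (s 2 \<otimes> s 1)}" (is "_ \<subseteq> ?K")
proof
  define a b where "a = s 1" and "b = s 2"
  have c: "a \<in> carrier G" "b \<in> carrier G" using assms by (simp_all add: a_def b_def)
  have aa: "a \<otimes> a = \<one>" and bb: "b \<otimes> b = \<one>"
    using three_points_squares[OF assms] by (simp_all add: a_def b_def)
  have cancel: "a \<otimes> (a \<otimes> x) = x" "b \<otimes> (b \<otimes> x) = x" if "x \<in> carrier G" for x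
    using that c aa bb by (simp_all flip: m_assoc)
  have bab: "b \<otimes> (a \<otimes> b) = a \<otimes> (b \<otimes> a)"
    using braid[of 1] assms by (simp add: numeral_2_eq_2 a_def b_def)
  have "b \<otimes> (a \<otimes> (b \<otimes> a)) = a \<otimes> b"
    using c bab cancel by (simp flip: bab)
  note mult = this aa bb bab cancel
  have inv_gens: "inv a = a" "inv b = b" using c aa bb by (simp_all add: inv_equality)
  have gens: "s ` {1..<n} = {a, b}"
    using assms by (auto simp: a_def b_def numeral_2_eq_2 numeral_3_eq_3 less_Suc_eq image_iff)
  fix y assume "y \<in> carrier G"
  then have "y \<in> generate G {a, b}" using generated gens by simp
  define K where "K = {\<one>, a, b, a \<otimes> b, b \<otimes> a, a \<otimes> (b \<otimes> a)}"
  have K: "K \<subseteq> carrier G" using c by (auto simp: K_def)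
  have "\<forall>k\<in>K. h \<otimes> k \<in> K" if "h = a \<or> h = b" for h
    using that c by (auto simp: K_def mult)
  note gen_mult_K = this
  from \<open>y \<in> generate G {a, b}\<close> have "y \<in> carrier G \<and> (\<forall>k\<in>K. y \<otimes> k \<in> K)"
  proof (induction rule: generate.induct)
    case one
    show ?case using K by auto
  next
    case (incl h)
    then show ?case using gen_mult_K[of h] c by auto
  next
    case (inv h)
    then have "inv h = h" using inv_gens by auto
    then show ?case using gen_mult_K[of h] inv c by auto
  next
    case (eng h1 h2)
    have "(h1 \<otimes> h2) \<otimes> k \<in> K" if "k \<in> K" for k
    proof -
      have "(h1 \<otimes> h2) \<otimes> k = h1 \<otimes> (h2 \<otimes> k)"
        using eng K that by (intro m_assoc) auto
      then show ?thesis using eng that by simp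
    qed
    then show ?case using eng by simp
  qed
  moreover have "\<one> \<in> K" by (simp add: K_def)
  ultimately have "y \<otimes> \<one> \<in> K" "y \<in> carrier G" by blast+
  then show "y \<in> ?K" by (simp add: K_def a_def b_def)
qed

end

text \<open>The six products are sent to six distinct permutations, and \<open>sym_group 3\<close> has no others.\<close>

lemma (in sphere_mcg_system) three_points_iso_sym_group:
  assumes n: "n = 3" and h: "h \<in> hom G (sym_group 3)"
    "h (s 1) = Transposition.transpose 1 2" "h (s 2) = Transposition.transpose 2 3"
  shows "h \<in> iso G (sym_group 3)"
proof -
  let ?K = "[\<one>, s 1, s 2, s 1 \<otimes> s 2, s 2 \<otimes> s 1, s 1 \<otimes> (s 2 \<otimes> s 1)]"
  interpret h: group_hom G "sym_group 3" h
    using h(1) by (simp add: group_hom_def group_hom_axioms_def sym_group_is_group is_group)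
  have c: "s 1 \<in> carrier G" "s 2 \<in> carrier G" using n by simp_all
  have K: "carrier G = set ?K"
    using three_points_elements[OF n] c by auto
  have fin: "finite (carrier G)" unfolding K by simp
  let ?t = "Transposition.transpose (1::nat) 2" and ?u = "Transposition.transpose (2::nat) 3"
  have image: "h ` carrier G = {id, ?t, ?u, ?t \<circ> ?u, ?u \<circ> ?t, ?t \<circ> (?u \<circ> ?t)}"
    unfolding K using c h(2,3) h.hom_one by (simp add: sym_group_mult sym_group_one)
  \<comment> \<open>A permutation of three points is determined by its values at two of them.\<close>
  have "card ((\<lambda>p. (p 1, p 2)) ` h ` carrier G) = 6"
    unfolding image by (simp add: Transposition.transpose_def)
  moreover have "card ((\<lambda>p. (p 1, p 2)) ` h ` carrier G) \<le> card (h ` carrier G)"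
    using fin by (intro card_image_le) simp
  moreover have "card (carrier G) \<le> 6"
    unfolding K using card_length[of ?K] by simp
  moreover have "card (h ` carrier G) \<le> card (carrier G)"
    using fin by (rule card_image_le)
  ultimately have card: "card (h ` carrier G) = card (carrier G)" "card (h ` carrier G) = 6"
    by linarith+
  have "card (carrier (sym_group 3)) = 6"
    using card_permutations[OF HOL.refl, of "{1..3::nat}"] 
    by (simp add: sym_group_def fact_numeral)
  moreover have "finite (carrier (sym_group 3))"
    by (simp add: sym_group_def finite_permutations)
  ultimately have "h ` carrier G = carrier (sym_group 3)"
    using card(2) by (intro card_subset_eq) auto
  moreover have "inj_on h (carrier G)"
    using fin card(1) by (rule eq_card_imp_inj_on)
  ultimately show ?thesis
    using h(1) by (simp add: iso_def bij_betw_def)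
qed

lemma (in marked_sphere) three_points_sym_group:
  assumes "n = 3"
  shows "M \<cong> sym_group 3"
proof -
  let ?S = "sym_group 3" and ?f = "\<lambda>i. swap i"
  interpret S: group ?S by (rule sym_group_is_group)
  obtain h where h: "h \<in> hom M ?S"
    "\<And>w. w \<in> words {1..<n} \<Longrightarrow> h (proj (pres_class {1..<n} rels w)) = eval_word ?S ?f w"
  proof (rule hom_M_if_von_Dyck[OF S.is_group])
    show "?f \<in> {1..<n} \<rightarrow> carrier ?S"
      using assms swap_permutes[of _ 3] by (auto simp: sym_group_carrier)
    show "eval_word ?S ?f u = eval_word ?S ?f v" if "(u, v) \<in> rels" for u v
      using that
    proof (cases rule: sphere_braid_rels_cases)
      case (far i j)
      then show ?thesis using assms by auto
    next
      case (braid i)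
      then have "i = 1" using assms by auto
      then show ?thesis
        using braid by (simp add: sym_group_mult sym_group_one fun_eq_iff Transposition.transpose_def)
    next
      case sphere
      have "[1..<n] = [1, 2]" using assms by (simp add: upt_conv_Cons)
      then show ?thesis
        using sphere by (simp add: sym_group_mult sym_group_one fun_eq_iff)
    qed
    have w: "[1..<n] = [1, 2]" using assms by (simp add: upt_conv_Cons)
    show "eval_word ?S ?f (word_power n (sigma_word [1..<n])) = \<one>\<^bsub>?S\<^esub>"
      unfolding w assms 
      by (simp add: numeral_3_eq_3 sym_group_mult sym_group_one fun_eq_iff Transposition.transpose_def)
  qed blast
  have "h (((\<lambda>x. proj x) \<circ> sphere_sigma n) i) = swap i" if "i \<in> {1, 2}" for i
    unfolding M_generator using h(2)[of "[(i, True)]"] that assms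
    by (auto simp: sym_group_mult sym_group_one)
  then have "h (((\<lambda>x. proj x) \<circ> sphere_sigma n) 1) = Transposition.transpose 1 2"
    "h (((\<lambda>x. proj x) \<circ> sphere_sigma n) 2) = Transposition.transpose 2 3"
    by (simp_all add: numeral_2_eq_2 numeral_3_eq_3)
  from M.three_points_iso_sym_group[OF assms h(1) this] show ?thesis
    by (auto simp: is_iso_def)
qed

section \<open>Isomorphic copies and the geometric group\<close>

lemma (in group) Mod_normal_closure_one: "G Mod normal_closure G \<one> \<cong> G"
proof -
  interpret i: group_hom G G id
    by (simp add: group_hom_def group_hom_axioms_def is_group hom_def)
  have "normal_closure G \<one> \<subseteq> kernel G G id"
    by (rule i.normal_closure_subset_kernel) simp_all
  moreover have "\<one> \<in> normal_closure G \<one>" by (rule mem_normal_closure)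
  ultimately have "normal_closure G \<one> = kernel G G id" by (auto simp: kernel_def)
  then show ?thesis using i.FactGroup_iso by simp
qed

text \<open>A multiplicative bijection from a group makes the target a group except for the choice of its unit,
  which is an additional component of the structure. Idempotence identifies it.\<close>

lemma (in group) iso_imp_group_if_one_idempotent:
  assumes f: "f \<in> iso G H"
    and one: "\<one>\<^bsub>H\<^esub> \<in> carrier H" "\<one>\<^bsub>H\<^esub> \<otimes>\<^bsub>H\<^esub> \<one>\<^bsub>H\<^esub> = \<one>\<^bsub>H\<^esub>"
  shows "group H"
proof -
  have "\<one>\<^bsub>H\<^esub> \<in> f ` carrier G"
    using f one(1) by (simp add: iso_def bij_betw_def)
  then obtain e where e: "e \<in> carrier G" "f e = \<one>\<^bsub>H\<^esub>"
    by (elim imageE) simp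
  then have "f (e \<otimes> e) = f e"
    using f one(2) by (simp add: iso_def hom_def)
  then have "e \<otimes> e = e"
    using f e(1) by (auto simp: iso_def bij_betw_def inj_on_def)
  then have "e = \<one>" using e(1) by simp
  then have "H\<lparr>one := f \<one>\<rparr> = H" using e(2) by simp
  then show ?thesis using iso_imp_img_group[OF f] by simp
qed

text \<open>By the preceding lemma it is enough that the homeomorphisms isotopic to the identity contain the identity and
  are closed under composition: if \<open>f\<close> and \<open>g\<close> are isotopic to the identity relative to \<open>P\<close>, composing an
  isotopy from the identity to \<open>g\<close> with \<open>f\<close> gives one from \<open>f\<close> to the composition.\<close>

lemma group_sphere_mcg:
  assumes "group G" "f \<in> iso G (sphere_mcg P)" and P: "P \<subseteq> topspace (nsphere 2)"
  shows "group (sphere_mcg P)"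
proof (rule group.iso_imp_group_if_one_idempotent[OF assms(1,2)])
  let ?X = "nsphere 2" and ?H = "sphere_homeo_group P"
  let ?S = "topspace ?X"
  let ?id = "\<lambda>x\<in>?S. x"
  define Q where "Q = (\<lambda>h. homeomorphic_map ?X ?X h \<and> (\<forall>x\<in>P. h x = ?id x))"
  define I where "I = {f \<in> carrier ?H. homotopic_with Q ?X ?X ?id f}"
  have carrier: "carrier ?H =
      {f \<in> extensional ?S. homeomorphic_map ?X ?X f \<and> Brouwer_degree2 2 f = 1 \<and> f ` P = P}"
    and one: "\<one>\<^bsub>?H\<^esub> = ?id" and mult: "monoid.mult ?H = compose ?S"
    by (simp_all add: sphere_homeo_group_def)
  have mcg: "sphere_mcg P = ?H Mod I"
    by (simp add: sphere_mcg_def I_def isotopic_rel_def Q_def one)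
  have id_homeo: "homeomorphic_map ?X ?X ?id"
    by (rule homeomorphic_map_eq[of _ _ id]) auto
  have "Brouwer_degree2 2 ?id = 1"
    using Brouwer_degree2_eq[of 2 ?id id] by simp
  moreover have "?id ` P = P" using P by (auto simp: subset_iff image_iff)
  ultimately have id_carrier: "?id \<in> carrier ?H"
    using id_homeo by (simp add: carrier)
  have "Q ?id" using id_homeo by (simp add: Q_def)
  then have id_I: "?id \<in> I"
    using id_carrier homeomorphic_imp_continuous_map[OF id_homeo] by (simp add: I_def)
  have compose_id: "compose ?S f ?id = f" if "f \<in> I" for f
    using that by (auto simp: I_def carrier compose_def extensional_def fun_eq_iff)
  have compose_I: "compose ?S f g \<in> I" if f: "f \<in> I" and g: "g \<in> I" for f g
  proof -
    have hf: "homeomorphic_map ?X ?X f" and hg: "homeomorphic_map ?X ?X g"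
      and df: "Brouwer_degree2 2 f = 1" and dg: "Brouwer_degree2 2 g = 1"
      and Pf: "f ` P = P" and Pg: "g ` P = P"
      and If: "homotopic_with Q ?X ?X ?id f" and Ig: "homotopic_with Q ?X ?X ?id g"
      using f g by (auto simp: I_def carrier)
    have Qf: "Q f" using homotopic_with_imp_property[OF If] by blast
    have Qg: "Q g" using homotopic_with_imp_property[OF Ig] by blast
    have comp: "homeomorphic_map ?X ?X (f \<circ> j)" if "homeomorphic_map ?X ?X j" for j
      using homeomorphic_map_compose[OF that hf] .
    have Q_comp: "Q (f \<circ> j)" if "Q j" for j
      using that Qf comp P by (auto simp: Q_def subset_iff)
    have eq: "compose ?S f g x = (f \<circ> g) x" if "x \<in> ?S" for x
      using that by (simp add: compose_def)
    have homeo: "homeomorphic_map ?X ?X (compose ?S f g)"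
      by (rule homeomorphic_map_eq[OF comp[OF hg]]) (simp add: eq)
    have "Brouwer_degree2 2 (compose ?S f g) = Brouwer_degree2 2 (f \<circ> g)"
      by (rule Brouwer_degree2_eq) (rule eq)
    also have "\<dots> = 1"
      using Brouwer_degree2_compose[of 2 g f] hf hg df dg
      by (simp add: homeomorphic_imp_continuous_map)
    finally have "Brouwer_degree2 2 (compose ?S f g) = 1" .
    moreover have "compose ?S f g ` P = P"
    proof -
      have "compose ?S f g ` P = f ` g ` P"
        using P by (auto simp: compose_def subset_iff image_iff)
      then show ?thesis using Pf Pg by simp
    qed
    ultimately have "compose ?S f g \<in> carrier ?H"
      using homeo by (simp add: carrier)
    moreover have "homotopic_with Q ?X ?X ?id (compose ?S f g)"
    proof -
      have "homotopic_with Q ?X ?X (f \<circ> ?id) (f \<circ> g)"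
        by (rule homotopic_with_compose_continuous_map_left[OF Ig homeomorphic_imp_continuous_map[OF hf]])
          (rule Q_comp)
      moreover have "homotopic_with Q ?X ?X f (f \<circ> ?id)"
        using Qf Q_comp[OF \<open>Q ?id\<close>] homeomorphic_imp_continuous_map[OF hf]
        by (intro homotopic_with_equal) auto
      moreover have "homotopic_with Q ?X ?X (f \<circ> g) (compose ?S f g)"
        using Q_comp[OF Qg] homeo homeomorphic_imp_continuous_map[OF comp[OF hg]] eq P
        by (intro homotopic_with_equal) (auto simp: Q_def subset_iff)
      ultimately show ?thesis
        using If by (blast intro: homotopic_with_trans)
    qed
    ultimately show ?thesis by (simp add: I_def)
  qed
  have "I #>\<^bsub>?H\<^esub> ?id = I"
    using compose_id by (auto simp: r_coset_def mult)
  then show "\<one>\<^bsub>sphere_mcg P\<^esub> \<in> carrier (sphere_mcg P)"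
    using id_carrier unfolding mcg one_FactGroup carrier_FactGroup by (metis image_eqI)
  have "I <#>\<^bsub>?H\<^esub> I = I"
  proof (intro equalityI subsetI)
    fix f assume "f \<in> I <#>\<^bsub>?H\<^esub> I"
    then show "f \<in> I" using compose_I by (auto simp: set_mult_def mult)
  next
    fix f assume "f \<in> I"
    then show "f \<in> I <#>\<^bsub>?H\<^esub> I"
      using id_I compose_id[of f] unfolding set_mult_def mult by force
  qed
  then show "\<one>\<^bsub>sphere_mcg P\<^esub> \<otimes>\<^bsub>sphere_mcg P\<^esub> \<one>\<^bsub>sphere_mcg P\<^esub> = \<one>\<^bsub>sphere_mcg P\<^esub>"
    by (simp add: mcg)
qed

text \<open>An isomorphic copy of the mapping class group satisfies the same relations and has the same length
  homomorphisms.\<close>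

theorem (in marked_sphere) isomorphic_copy:
  assumes H: "group H" and f: "f \<in> iso M H"
  shows "(odd n \<longrightarrow>
        normal_closure H (f (braid_mcg_alpha n 1)) = carrier H \<and> strongly_torsion_generated H (n - 1))
      \<and> (even n \<longrightarrow>
        \<not> (\<exists>x. torsion_element H x \<and> normal_closure H x = carrier H)
        \<and> H Mod normal_closure H (f (braid_mcg_alpha n 1)) \<cong> integer_mod_group 2)
      \<and> (\<forall>i\<in>{0, 2}. \<not> (n = 3 \<and> i = 2) \<longrightarrow>
        H Mod normal_closure H (f (braid_mcg_alpha n i)) \<cong> integer_mod_group (n - 1))
      \<and> (n = 3 \<longrightarrow>
        H Mod normal_closure H (f (braid_mcg_alpha n 2)) \<cong> H \<and> H \<cong> sym_group 3)"
proof -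
  have fh: "f \<in> hom M H" "f ` carrier M = carrier H"
    using f by (auto simp: iso_def bij_betw_def)
  let ?s = "(\<lambda>x. proj x) \<circ> sphere_sigma n"
  interpret H: sphere_mcg_system H n "f \<circ> ?s"
    by (rule M.sphere_mcg_system_onto[OF H fh])
  interpret f: group_hom M H f
    using fh(1) by (simp add: group_hom_def group_hom_axioms_def M.is_group H)
  have rot: "f (M.rot m) = H.rot m" if "m \<le> n" for m
    using M.rot_image[OF H fh(1) that] by simp
  have rot1: "f (M.rot1 m) = H.rot1 m" if "2 \<le> m" "m \<le> n" for m
    using rot[OF that(2)] f.hom_mult[of "M.rot m" "?s (m - 1)"] M.gen_closed[of "m - 1"] that
    by simp
  have alpha: "f (braid_mcg_alpha n 0) = H.rot n" "f (braid_mcg_alpha n 1) = H.rot1 n"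
    "f (braid_mcg_alpha n 2) = H.rot1 (n - 1)"
    unfolding alpha_eq using rot[of n] rot1[of n] rot1[of "n - 1"] three_le by simp_all
  have len: "H.has_length_hom k" if k: "0 < k" "k dvd 2 * (n - 1)" "k dvd n * (n - 1)" for k
  proof -
    obtain h where h: "h \<in> hom M (integer_mod_group k)"
      "\<And>i. \<lbrakk>1 \<le> i; i < n\<rbrakk> \<Longrightarrow> h (?s i) = 1 mod int k"
      using M_has_length_hom[OF k] unfolding M.has_length_hom_def by blast
    let ?g = "inv_into (carrier M) f"
    have "?g \<in> hom H M" using M.iso_set_sym[OF f] by (simp add: iso_def)
    then have "h \<circ> ?g \<in> hom H (integer_mod_group k)" using h(1) by (rule hom_compose)
    moreover have "(h \<circ> ?g) ((f \<circ> ?s) i) = 1 mod int k" if "1 \<le> i" "i < n" for i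
    proof -
      have "inj_on f (carrier M)" using f by (simp add: iso_def bij_betw_def)
      then have "?g (f (?s i)) = ?s i" using M.gen_closed[OF that] by (rule inv_into_f_f)
      then show ?thesis using h(2)[OF that] by simp
    qed
    ultimately show ?thesis unfolding H.has_length_hom_def by blast
  qed
  have len1: "H.has_length_hom (n - 1)" using three_le by (intro len) auto
  have len2: "H.has_length_hom 2" by (rule len) auto
  show ?thesis
  proof (intro conjI impI ballI)
    assume "odd n"
    then show "normal_closure H (f (braid_mcg_alpha n 1)) = carrier H"
      unfolding alpha by (rule H.normal_closure_rot1)
    show "strongly_torsion_generated H (n - 1)"
      using len1 \<open>odd n\<close> by (rule H.strongly_torsion_generated_odd)
  next
    assume "even n"
    then show "\<not> (\<exists>x. torsion_element H x \<and> normal_closure H x = carrier H)"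
      using no_torsion_normal_generator[OF _ H f] by blast
    show "H Mod normal_closure H (f (braid_mcg_alpha n 1)) \<cong> integer_mod_group 2"
      unfolding alpha using len2 \<open>even n\<close> by (rule H.Mod_rot1)
  next
    fix i :: nat assume "i \<in> {0, 2}" "\<not> (n = 3 \<and> i = 2)"
    then consider "i = 0" | "i = 2" "4 \<le> n" using three_le by fastforce
    then show "H Mod normal_closure H (f (braid_mcg_alpha n i)) \<cong> integer_mod_group (n - 1)"
    proof cases
      case 1
      then show ?thesis using H.Mod_rot[OF len1] alpha(1) by simp
    next
      case 2
      then show ?thesis using H.Mod_rot1_pred[OF len1] alpha(3) by simp
    qed
  next
    assume n: "n = 3"
    show "H Mod normal_closure H (f (braid_mcg_alpha n 2)) \<cong> H"
      unfolding alpha H.three_points_rot1_pred[OF n] by (rule H.Mod_normal_closure_one)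
    have "H \<cong> M" using M.iso_set_sym[OF f] by (auto simp: is_iso_def)
    then show "H \<cong> sym_group 3"
      using three_points_sym_group[OF n] by (rule iso_trans)
  qed
qed

theorem proposition14:
  fixes n :: nat
  assumes "n \<ge> 3"
  shows
    "((odd n \<longrightarrow>
        normal_closure (braid_mcg n) (braid_mcg_alpha n 1) = carrier (braid_mcg n)
        \<and> strongly_torsion_generated (braid_mcg n) (n - 1))
      \<and> (even n \<longrightarrow>
        \<not> (\<exists>x. torsion_element (braid_mcg n) x
               \<and> normal_closure (braid_mcg n) x = carrier (braid_mcg n))
        \<and> braid_mcg n Mod normal_closure (braid_mcg n) (braid_mcg_alpha n 1)
            \<cong> integer_mod_group 2)
      \<and> (\<forall>i\<in>{0, 2}. \<not> (n = 3 \<and> i = 2) \<longrightarrow>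
        braid_mcg n Mod normal_closure (braid_mcg n) (braid_mcg_alpha n i)
          \<cong> integer_mod_group (n - 1))
      \<and> (n = 3 \<longrightarrow>
        braid_mcg n Mod normal_closure (braid_mcg n) (braid_mcg_alpha n 2) \<cong> braid_mcg n
        \<and> braid_mcg n \<cong> sym_group 3))
    \<and> (\<forall>P \<phi>. P \<subseteq> topspace (nsphere 2) \<and> card P = n \<and> \<phi> \<in> iso (braid_mcg n) (sphere_mcg P) \<longrightarrow>
      (odd n \<longrightarrow>
        normal_closure (sphere_mcg P) (\<phi> (braid_mcg_alpha n 1)) = carrier (sphere_mcg P)
        \<and> strongly_torsion_generated (sphere_mcg P) (n - 1))
      \<and> (even n \<longrightarrow>
        \<not> (\<exists>x. torsion_element (sphere_mcg P) x
               \<and> normal_closure (sphere_mcg P) x = carrier (sphere_mcg P))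
        \<and> sphere_mcg P Mod normal_closure (sphere_mcg P) (\<phi> (braid_mcg_alpha n 1))
            \<cong> integer_mod_group 2)
      \<and> (\<forall>i\<in>{0, 2}. \<not> (n = 3 \<and> i = 2) \<longrightarrow>
        sphere_mcg P Mod normal_closure (sphere_mcg P) (\<phi> (braid_mcg_alpha n i))
          \<cong> integer_mod_group (n - 1))
      \<and> (n = 3 \<longrightarrow>
        sphere_mcg P Mod normal_closure (sphere_mcg P) (\<phi> (braid_mcg_alpha n 2)) \<cong> sphere_mcg P
        \<and> sphere_mcg P \<cong> sym_group 3))"
proof -
  interpret marked_sphere n by unfold_locales fact
  have id: "(\<lambda>x. x) \<in> iso (braid_mcg n) (braid_mcg n)"
    by (simp add: iso_def hom_def bij_betw_def)
  have "group (sphere_mcg P)"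
    if "P \<subseteq> topspace (nsphere 2)" "\<phi> \<in> iso (braid_mcg n) (sphere_mcg P)" for P \<phi>
    using group_sphere_mcg[OF group_M that(2,1)] .
  note geometric = isomorphic_copy[OF this]
  show ?thesis
    by (rule conjI[OF isomorphic_copy[OF group_M id]], intro allI impI, elim conjE, rule geometric)
qed

end
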